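(* Let $G$ be a simple connected plane graph all of whose faces are bounded by simple cycles. Then $\mathrm{AT}(\overline{G}_{ve})\leqslant 6$.
   Context: Let $V,E$ be the vertex and edge sets of $G$. Two edges of $G$ are facially adjacent if they share a vertex and lie on the boundary of a common face of $G$. The facial total graph $\overline{G}_{ve}$ is the simple graph with vertex set $V\cup E$ in which: two elements of $V$ are adjacent iff they are adjacent in $G$; two elements of $E$ are adjacent iff they are facially adjacent edges of $G$; a vertex $v\in V$ and an edge $e\in E$ are adjacent iff $v$ is an endpoint of $e$. For a finite simple graph $H$ with vertex set $\{v_1,\dots,v_N\}$, the graph polynomial is $P_H=\prod_{v_iv_j\in E(H)}(v_i-v_j)\in\mathbb{R}[v_1,\dots,v_N]$ (one factor per edge, with a fixed choice of sign). The Alon–Tarsi number $\mathrm{AT}(H)$ is the least integer $k$ such that $P_H$ contains a monomial with nonzero coefficient in which every variable has degree at most $k-1$. *)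

theory Defs
  imports "HOL-Analysis.Analysis" "HOL-Library.Poly_Mapping"
begin

section \<open>Graph polynomial and Alon--Tarsi number\<close>

text \<open>
  A finite simple graph is given by a vertex set and a set of edges, each edge being a two-element
  set of vertices. Real polynomials with variables indexed by \<open>'a\<close> are the elements of
  \<open>('a \<Rightarrow>\<^sub>0 nat) \<Rightarrow>\<^sub>0 real\<close>, i.e. finitely supported maps from exponent vectors to coefficients.
\<close>

definition var :: "'a \<Rightarrow> (('a \<Rightarrow>\<^sub>0 nat) \<Rightarrow>\<^sub>0 real)" where
  "var x = Poly_Mapping.single (Poly_Mapping.single x 1) 1"

text \<open>\<open>SOME\<close> makes the fixed choice of the sign of each factor.\<close>

definition orient :: "'a set \<Rightarrow> 'a \<times> 'a" where
  "orient d = (SOME p. d = {fst p, snd p})"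

definition graph_polynomial :: "'a set set \<Rightarrow> (('a \<Rightarrow>\<^sub>0 nat) \<Rightarrow>\<^sub>0 real)" where
  "graph_polynomial D = (\<Prod>d\<in>D. var (fst (orient d)) - var (snd (orient d)))"

text \<open>
  The condition ``degree at most \<open>k - 1\<close>'' is written as ``degree \<open>< k\<close>'', since subtraction
  on \<open>nat\<close> truncates at \<open>k = 0\<close>.
\<close>

definition Alon_Tarsi_number :: "'a set \<Rightarrow> 'a set set \<Rightarrow> nat" where
  "Alon_Tarsi_number W D =
     (LEAST k. \<exists>m. Poly_Mapping.lookup (graph_polynomial D) m \<noteq> 0 \<and>
                   (\<forall>w\<in>W. Poly_Mapping.lookup m w < k))"

section \<open>Plane graphs\<close>

text \<open>
  A plane graph has points of the plane as vertices and arcs (as point sets) as edges. Every edge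
  joins two vertices, and its interior contains no vertex and no point of another edge. Hence the
  endpoints of an edge are exactly the vertices lying on it. Simplicity means that distinct
  edges have distinct endpoint sets; loops are impossible because an arc has distinct endpoints.
\<close>

definition ends :: "complex set \<Rightarrow> complex set \<Rightarrow> complex set" where
  "ends V e = e \<inter> V"

definition simple_plane_graph :: "complex set \<Rightarrow> complex set set \<Rightarrow> bool" where
  "simple_plane_graph V E \<longleftrightarrow>
     finite V \<and> finite E \<and>
     (\<forall>e\<in>E. \<exists>g. arc g \<and> path_image g = e \<and> ends V e = {pathstart g, pathfinish g}) \<and>
     (\<forall>e\<in>E. \<forall>f\<in>E. e \<noteq> f \<longrightarrow> e \<inter> f \<subseteq> V) \<and>
     inj_on (ends V) E"

definition adjacent :: "complex set \<Rightarrow> complex set set \<Rightarrow> complex \<Rightarrow> complex \<Rightarrow> bool" where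
  "adjacent V E u v \<longleftrightarrow> u \<noteq> v \<and> (\<exists>e\<in>E. ends V e = {u, v})"

definition graph_connected :: "complex set \<Rightarrow> complex set set \<Rightarrow> bool" where
  "graph_connected V E \<longleftrightarrow> V \<noteq> {} \<and> (\<forall>u\<in>V. \<forall>v\<in>V. (adjacent V E)\<^sup>*\<^sup>* u v)"

definition faces :: "complex set \<Rightarrow> complex set set \<Rightarrow> complex set set" where
  "faces V E = components (- (V \<union> \<Union>E))"

text \<open>\<open>es ! i\<close> joins \<open>vs ! i\<close> to its cyclic successor.\<close>

definition simple_cycle ::
    "complex set \<Rightarrow> complex set set \<Rightarrow> complex list \<Rightarrow> complex set list \<Rightarrow> bool" where
  "simple_cycle V E vs es \<longleftrightarrow>
     3 \<le> length vs \<and> length es = length vs \<and> distinct vs \<and> set vs \<subseteq> V \<and> set es \<subseteq> E \<and>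
     (\<forall>i<length vs. ends V (es ! i) = {vs ! i, vs ! (Suc i mod length vs)})"

definition bounded_by_simple_cycle ::
    "complex set \<Rightarrow> complex set set \<Rightarrow> complex set \<Rightarrow> bool" where
  "bounded_by_simple_cycle V E F \<longleftrightarrow>
     (\<exists>vs es. simple_cycle V E vs es \<and> frontier F = \<Union>(set es))"

section \<open>The facial total graph\<close>

definition facially_adjacent ::
    "complex set \<Rightarrow> complex set set \<Rightarrow> complex set \<Rightarrow> complex set \<Rightarrow> bool" where
  "facially_adjacent V E e f \<longleftrightarrow>
     e \<noteq> f \<and> ends V e \<inter> ends V f \<noteq> {} \<and>
     (\<exists>F\<in>faces V E. e \<subseteq> frontier F \<and> f \<subseteq> frontier F)"

definition facial_total_vertices ::
    "complex set \<Rightarrow> complex set set \<Rightarrow> (complex + complex set) set" where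
  "facial_total_vertices V E = V <+> E"

definition facial_total_edges ::
    "complex set \<Rightarrow> complex set set \<Rightarrow> (complex + complex set) set set" where
  "facial_total_edges V E =
     {{Inl u, Inl v} | u v. u \<in> V \<and> v \<in> V \<and> adjacent V E u v} \<union>
     {{Inr e, Inr f} | e f. e \<in> E \<and> f \<in> E \<and> facially_adjacent V E e f} \<union>
     {{Inl v, Inr e} | v e. v \<in> V \<and> e \<in> E \<and> v \<in> ends V e}"

end

(* The total graph has the vertices of G and the edges of G as its elements. Eliminate them one by
   one from the graph polynomial, taking for each element the power equal to the number of its
   remaining neighbours. An element e of E has at most two neighbours in V and four in E, and the
   facial adjacency graph M on E is connected, so once one element of E has been dealt with, the
   others can be taken with degree at most 5; after E, what is left is the planar graph G itself,
   which is 5-degenerate.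

   Only the first element of E, of degree 6, is a problem. It is used to the power 5, which leaves a
   linear form as an extra factor. If no monomial with all degrees at most 5 survived, the
   coefficients of this form would satisfy so many relations that M could contain neither an induced
   even cycle nor an induced odd cycle with a path outside it between two of its vertices, much as in
   the proof of Brooks' theorem. But the edges of a face form an induced cycle of M, and such
   a path exists because the boundary of a set of faces has even degree at every vertex.

   The plane topology enters through the Jordan curve theorem: every face is one side of its
   frontier cycle, winding numbers show that an edge lies on exactly two faces, and every cycle is the
   boundary of the set of faces inside it. This last fact gives Euler's formula for all subgraphs,
   hence 5-degeneracy. *)

theory Submission
  imports Defs "HOL-Complex_Analysis.Complex_Analysis"
begin

section \<open>Coefficient extraction in one variable\<close>

section \<open>Eliminating variables from the graph polynomial\<close>

text \<open>In the product of the factors \<open>z - y\<close> over the neighbours \<open>y\<close>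
  of \<open>z\<close>, only two coefficients matter: the leading one, 1, and the next one, minus the
  sum of the neighbours. Taking \<open>z\<close> to its full degree uses the first; taking it one
  time less leaves the second as a linear form. The form is discharged at a later vertex with
  non-zero coefficient and at most \<open>k - 1\<close> remaining neighbours, by taking this vertex
  one time more than its degree. Hence in a counterexample the coefficient at a vertex vanishes as
  soon as two of its neighbours have been eliminated. Along an induced cycle the propagated values
  alternate between 1 and -1, and the closing vertex excludes even length. For odd length the
  closing vertex gets the value 0 and can be any vertex of the cycle. The path outside the cycle is
  never constructed. A largest elimination around a vertex of value 0 shows instead that everything
  attached there hangs on this single vertex, and parity of boundaries rules that out for an edge of
  a face. The number 5 is one less than the largest degree, 2 + 4.\<close>

type_synonym 'a mpol = "('a \<Rightarrow>\<^sub>0 nat) \<Rightarrow>\<^sub>0 real"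

lemma lookup_single_times:
  "Poly_Mapping.lookup (Poly_Mapping.single k c * A) m =
     c * (\<Sum>q. Poly_Mapping.lookup (A :: 'a mpol) q when m = k + q)"
proof -
  have "Poly_Mapping.lookup (Poly_Mapping.single k c * A) m =
      (\<Sum>l. (c * (\<Sum>q. Poly_Mapping.lookup A q when m = l + q)) when l = k)"
    unfolding lookup_mult by (rule Sum_any.cong) (simp add: lookup_single when_def)
  then show ?thesis by simp
qed

lemma lookup_const_times:
  "Poly_Mapping.lookup (Poly_Mapping.single 0 c * A) m = c * Poly_Mapping.lookup (A :: 'a mpol) m"
  by (simp add: lookup_single_times)

lemma lookup_var_times:
  "Poly_Mapping.lookup (var x * A) m =
     (if Poly_Mapping.lookup m x = 0 then 0
      else Poly_Mapping.lookup A (m - Poly_Mapping.single x 1))"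
proof (cases "Poly_Mapping.lookup m x = 0")
  case True
  then have "m \<noteq> Poly_Mapping.single x (Suc 0) + q" for q
    by (auto simp: lookup_add)
  with True show ?thesis by (simp add: var_def lookup_single_times)
next
  case False
  have "Poly_Mapping.single x 1 + (m - Poly_Mapping.single x 1) = m"
  proof (rule poly_mapping_eqI)
    fix w
    show "Poly_Mapping.lookup (Poly_Mapping.single x 1 + (m - Poly_Mapping.single x 1)) w =
        Poly_Mapping.lookup m w"
      using False by (cases "w = x") (auto simp: lookup_add lookup_minus lookup_single)
  qed
  then have "m = Poly_Mapping.single x 1 + q \<longleftrightarrow> q = m - Poly_Mapping.single x 1" for q
    by (metis add_left_cancel)
  with False show ?thesis by (simp add: var_def lookup_single_times)
qed

text \<open>The guard makes the result a polynomial in the other variables, so \<open>A\<close> is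
  the sum of the products of \<open>coef z d A\<close> with the powers \<open>d\<close> of
  \<open>var z\<close>.\<close>

definition coef :: "'a \<Rightarrow> nat \<Rightarrow> 'a mpol \<Rightarrow> 'a mpol" where
  "coef z d A = Abs_poly_mapping (\<lambda>m. if Poly_Mapping.lookup m z = 0
     then Poly_Mapping.lookup A (m + Poly_Mapping.single z d) else 0)"

lemma lookup_coef:
  "Poly_Mapping.lookup (coef z d A) m =
     (if Poly_Mapping.lookup m z = 0 then Poly_Mapping.lookup A (m + Poly_Mapping.single z d) else 0)"
proof -
  have "{m. (if Poly_Mapping.lookup m z = 0 then Poly_Mapping.lookup A (m + Poly_Mapping.single z d)
              else 0) \<noteq> 0} \<subseteq> (\<lambda>m. m - Poly_Mapping.single z d) ` Poly_Mapping.keys A"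
  proof
    fix m
    assume "m \<in> {m. (if Poly_Mapping.lookup m z = 0
      then Poly_Mapping.lookup A (m + Poly_Mapping.single z d) else 0) \<noteq> 0}"
    then have "m + Poly_Mapping.single z d \<in> Poly_Mapping.keys A"
      by (auto simp: in_keys_iff split: if_splits)
    then show "m \<in> (\<lambda>m. m - Poly_Mapping.single z d) ` Poly_Mapping.keys A"
      by (metis add_diff_cancel_right' imageI)
  qed
  then have "finite {m. (if Poly_Mapping.lookup m z = 0
    then Poly_Mapping.lookup A (m + Poly_Mapping.single z d) else 0) \<noteq> 0}"
    by (rule finite_surj[OF finite_keys])
  then show ?thesis
    unfolding coef_def by (simp add: lookup_Abs_poly_mapping)
qed

lemma coef_zero [simp]: "coef z d 0 = 0"
  by (rule poly_mapping_eqI) (simp add: lookup_coef)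

lemma coef_add: "coef z d (A + B) = coef z d A + coef z d B"
  by (rule poly_mapping_eqI) (simp add: lookup_coef lookup_add)

lemma coef_diff: "coef z d (A - B) = coef z d A - coef z d B"
  by (rule poly_mapping_eqI) (simp add: lookup_coef lookup_minus)

lemma coef_sum: "coef z d (sum f T) = (\<Sum>t\<in>T. coef z d (f t))"
  by (induction T rule: infinite_finite_induct) (simp_all add: coef_add)

lemma coef_const_times: "coef z d (Poly_Mapping.single 0 c * A) = Poly_Mapping.single 0 c * coef z d A"
  by (rule poly_mapping_eqI) (simp add: lookup_coef lookup_const_times)

lemma coef_var_other:
  assumes "z \<noteq> y"
  shows "coef z d (var y * A) = var y * coef z d A"
proof (rule poly_mapping_eqI)
  fix m
  have "m + Poly_Mapping.single z d - Poly_Mapping.single y 1 =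
        m - Poly_Mapping.single y 1 + Poly_Mapping.single z d"
    if "Poly_Mapping.lookup m y \<noteq> 0"
  proof (rule poly_mapping_eqI)
    fix w
    show "Poly_Mapping.lookup (m + Poly_Mapping.single z d - Poly_Mapping.single y 1) w =
        Poly_Mapping.lookup (m - Poly_Mapping.single y 1 + Poly_Mapping.single z d) w"
      using assms that by (cases "w = z"; cases "w = y")
        (auto simp: lookup_add lookup_minus lookup_single)
  qed
  note shift = this
  show "Poly_Mapping.lookup (coef z d (var y * A)) m = Poly_Mapping.lookup (var y * coef z d A) m"
  proof (cases "Poly_Mapping.lookup m y = 0")
    case True
    with assms show ?thesis
      by (simp add: lookup_coef lookup_var_times lookup_add lookup_single)
  next
    case False
    with assms show ?thesis
      unfolding lookup_coef lookup_var_times shift[OF False]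
      by (simp add: lookup_add lookup_minus lookup_single)
  qed
qed

lemma coef_var_same: "coef z (Suc d) (var z * A) = coef z d A"
proof (rule poly_mapping_eqI)
  fix m
  have "Poly_Mapping.single z (Suc d) = Poly_Mapping.single z d + Poly_Mapping.single z 1"
    by (simp only: single_add[symmetric] Suc_eq_plus1)
  then have "m + Poly_Mapping.single z (Suc d) - Poly_Mapping.single z 1 = m + Poly_Mapping.single z d"
    by (simp only: add.assoc[symmetric] add_diff_cancel_right')
  note shift = this
  show "Poly_Mapping.lookup (coef z (Suc d) (var z * A)) m = Poly_Mapping.lookup (coef z d A) m"
    unfolding lookup_coef lookup_var_times shift by (simp add: lookup_add)
qed

lemma coef_0_var_same: "coef z 0 (var z * A) = 0"
  by (rule poly_mapping_eqI) (auto simp: lookup_coef lookup_var_times)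

definition var_free :: "'a \<Rightarrow> 'a mpol \<Rightarrow> bool" where
  "var_free z A \<longleftrightarrow> (\<forall>m. Poly_Mapping.lookup A m \<noteq> 0 \<longrightarrow> Poly_Mapping.lookup m z = 0)"

lemma coef_0_free: "var_free z A \<Longrightarrow> coef z 0 A = A"
  by (rule poly_mapping_eqI) (auto simp: lookup_coef var_free_def)

lemma coef_Suc_free: "var_free z A \<Longrightarrow> coef z (Suc d) A = 0"
  by (rule poly_mapping_eqI) (fastforce simp: lookup_coef lookup_add var_free_def)

lemma var_free_one: "var_free z 1"
  by (auto simp: var_free_def lookup_one when_def)

lemma var_free_diff_times:
  assumes "var_free z A" "x \<noteq> z" "y \<noteq> z"
  shows "var_free z ((var x - var y) * A)"
  unfolding var_free_def
proof (intro allI impI)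
  fix m
  assume "Poly_Mapping.lookup ((var x - var y) * A) m \<noteq> 0"
  then have "Poly_Mapping.lookup (var x * A) m \<noteq> 0 \<or> Poly_Mapping.lookup (var y * A) m \<noteq> 0"
    by (auto simp: left_diff_distrib lookup_minus)
  then show "Poly_Mapping.lookup m z = 0"
    using assms unfolding var_free_def lookup_var_times
    by (metis diff_zero lookup_minus lookup_single_not_eq)
qed

text \<open>With \<open>Y\<close> the neighbours of \<open>z\<close>, this is up to sign the part of
  the graph polynomial that involves \<open>z\<close>.\<close>

definition star :: "'a \<Rightarrow> 'a set \<Rightarrow> 'a mpol" where
  "star z Y = (\<Prod>y\<in>Y. var z - var y)"

lemma star_insert:
  "finite Y \<Longrightarrow> y \<notin> Y \<Longrightarrow> star z (insert y Y) * A = (var z - var y) * (star z Y * A)"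
  by (simp add: star_def mult.assoc)

lemma coef_star_gt:
  assumes "finite Y" "z \<notin> Y" "var_free z A" "card Y < d"
  shows "coef z d (star z Y * A) = 0"
  using assms
proof (induction Y arbitrary: d rule: finite_induct)
  case empty
  then obtain d' where "d = Suc d'" by (cases d) auto
  with empty show ?case by (simp add: star_def coef_Suc_free)
next
  case (insert y Y)
  then obtain d' where d: "d = Suc d'" by (cases d) auto
  have "coef z d' (star z Y * A) = 0" "coef z (Suc d') (star z Y * A) = 0"
    using insert.IH[of d'] insert.IH[of "Suc d'"] insert.prems insert.hyps d by auto
  then show ?case
    using insert.prems insert.hyps
    by (simp add: star_insert d left_diff_distrib coef_diff coef_var_same coef_var_other)
qed

lemma coef_star_top:
  assumes "finite Y" "z \<notin> Y" "var_free z A"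
  shows "coef z (card Y) (star z Y * A) = A"
  using assms
proof (induction Y rule: finite_induct)
  case empty
  then show ?case by (simp add: star_def coef_0_free)
next
  case (insert y Y)
  then show ?case
    by (simp add: star_insert left_diff_distrib coef_diff coef_var_same coef_var_other coef_star_gt)
qed

text \<open>Vieta: as a polynomial in \<open>z\<close>, \<open>star z Y\<close> is monic with the
  roots \<open>var y\<close>, so its second coefficient is minus the sum of the roots.\<close>

lemma coef_star_sub:
  assumes "finite Y" "z \<notin> Y" "var_free z A" "card Y = Suc d"
  shows "coef z d (star z Y * A) = - ((\<Sum>y\<in>Y. var y) * A)"
  using assms
proof (induction Y arbitrary: d rule: finite_induct)
  case empty
  then show ?case by simp
next
  case (insert y Y)
  then have d: "d = card Y" by simp
  have top: "coef z (card Y) (star z Y * A) = A"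
    using insert.hyps(1) insert.prems(1,2) by (simp add: coef_star_top)
  show ?case
  proof (cases d)
    case 0
    with d insert.hyps have "Y = {}" by simp
    with insert.prems 0 show ?thesis
      by (simp add: star_def left_diff_distrib coef_diff coef_0_var_same coef_var_other coef_0_free)
  next
    case (Suc d')
    with d have Y: "card Y = Suc d'" by simp
    then have "coef z d' (star z Y * A) = - ((\<Sum>y\<in>Y. var y) * A)"
      using insert.IH[of d'] insert.prems by simp
    then show ?thesis
      unfolding Suc using insert.hyps insert.prems(1,2) top[unfolded Y]
      by (simp add: star_insert left_diff_distrib coef_diff coef_var_same coef_var_other
          distrib_right)
  qed
qed

text \<open>The bound is on all variables, not only on vertices of a given graph, so no vertex set
  is carried along.\<close>

definition capped :: "nat \<Rightarrow> 'a mpol \<Rightarrow> bool" where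
  "capped k A \<longleftrightarrow>
     (\<exists>m. Poly_Mapping.lookup A m \<noteq> 0 \<and> (\<forall>w. Poly_Mapping.lookup m w \<le> k))"

text \<open>A monomial of \<open>coef z d A\<close> does not contain \<open>z\<close>. Multiplied by
  the power \<open>d\<close> of \<open>z\<close> it is a monomial of \<open>A\<close> with the same
  coefficient, so nothing can cancel.\<close>

lemma capped_coef:
  assumes "capped k (coef z d A)" "d \<le> k"
  shows "capped k A"
proof -
  obtain m where m: "Poly_Mapping.lookup (coef z d A) m \<noteq> 0" "\<forall>w. Poly_Mapping.lookup m w \<le> k"
    using assms unfolding capped_def by blast
  then have "Poly_Mapping.lookup m z = 0" "Poly_Mapping.lookup A (m + Poly_Mapping.single z d) \<noteq> 0"
    by (auto simp: lookup_coef split: if_splits)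
  moreover have "Poly_Mapping.lookup (m + Poly_Mapping.single z d) w \<le> k" for w
    using m(2) assms(2) calculation(1) by (auto simp: lookup_add lookup_single when_def)
  ultimately show ?thesis unfolding capped_def by blast
qed

lemma capped_uminus [simp]: "capped k (- A) \<longleftrightarrow> capped k A"
  by (simp add: capped_def)

lemma capped_const:
  assumes "c \<noteq> 0" "capped k A"
  shows "capped k (Poly_Mapping.single 0 c * A)"
  using assms by (auto simp: capped_def lookup_const_times)

definition edge_poly :: "'a set \<Rightarrow> 'a mpol" where
  "edge_poly d = var (fst (orient d)) - var (snd (orient d))"

text \<open>The choice in \<open>orient\<close> fixes a factor only up to sign, and
  \<open>capped\<close> does not see signs.\<close>

lemma edge_poly_cases:
  assumes "x \<noteq> y"
  shows "edge_poly {x, y} = var x - var y \<or> edge_poly {x, y} = - (var x - var y)"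
proof -
  have "{x, y} = {fst (orient {x, y}), snd (orient {x, y})}"
    unfolding orient_def by (rule someI[of _ "(x, y)"]) simp
  then show ?thesis
    using assms unfolding edge_poly_def by (auto simp: doubleton_eq_iff)
qed

section \<open>Elimination of vertices from induced subgraphs\<close>

locale finite_graph =
  fixes D :: "'a set set"
  assumes edges: "d \<in> D \<Longrightarrow> \<exists>x y. x \<noteq> y \<and> d = {x, y}"
begin

definition nbs :: "'a \<Rightarrow> 'a set" where
  "nbs z = {y. {z, y} \<in> D}"

definition sub_poly :: "'a set \<Rightarrow> 'a mpol" where
  "sub_poly S = (\<Prod>d | d \<in> D \<and> d \<subseteq> S. edge_poly d)"

lemma nbs_irrefl: "z \<notin> nbs z"
  using edges[of "{z, z}"] by (auto simp: nbs_def)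

lemma nbs_sym: "y \<in> nbs z \<longleftrightarrow> z \<in> nbs y"
  by (simp add: nbs_def insert_commute)

lemma sub_poly_empty: "sub_poly {} = 1"
proof -
  have "{d. d \<in> D \<and> d \<subseteq> {}} = {}" using edges by blast
  then show ?thesis by (simp only: sub_poly_def prod.empty)
qed

lemma star_edges:
  assumes "finite Y" "z \<notin> Y"
  shows "(\<Prod>y\<in>Y. edge_poly {z, y}) = star z Y \<or> (\<Prod>y\<in>Y. edge_poly {z, y}) = - star z Y"
  using assms
proof (induction Y rule: finite_induct)
  case empty
  then show ?case by (simp add: star_def)
next
  case (insert y Y)
  then show ?case
    using edge_poly_cases[of z y] by (auto simp: star_def simp del: minus_diff_eq)
qed

lemma sub_poly_remove:
  assumes "finite S" "z \<in> S"
  shows "sub_poly S = star z (nbs z \<inter> S) * sub_poly (S - {z}) \<or>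
         sub_poly S = - (star z (nbs z \<inter> S) * sub_poly (S - {z}))"
proof -
  let ?A = "{d. d \<in> D \<and> d \<subseteq> S - {z}}" and ?B = "(\<lambda>y. {z, y}) ` (nbs z \<inter> S)"
  have "{d. d \<in> D \<and> d \<subseteq> S} = ?A \<union> ?B"
  proof (intro set_eqI iffI)
    fix d assume "d \<in> {d. d \<in> D \<and> d \<subseteq> S}"
    then have d: "d \<in> D" "d \<subseteq> S" by auto
    then obtain x y where xy: "d = {x, y}" "x \<noteq> y" using edges by blast
    show "d \<in> ?A \<union> ?B"
    proof (cases "z \<in> d")
      case True
      then have "z = x \<or> z = y" using xy by simp
      then obtain y' where "d = {z, y'}" using xy by (metis insert_commute)
      with d show ?thesis by (auto simp: nbs_def)
    qed (use d in auto)
  qed (use assms in \<open>auto simp: nbs_def\<close>)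
  moreover have "?A \<inter> ?B = {}" by auto
  moreover have "finite ?A" "finite ?B"
    using assms by (auto intro: finite_subset[of _ "Pow S"])
  moreover have "inj_on (\<lambda>y. {z, y}) (nbs z \<inter> S)"
    by (auto simp: inj_on_def doubleton_eq_iff)
  then have "(\<Prod>d\<in>?B. edge_poly d) = (\<Prod>y\<in>nbs z \<inter> S. edge_poly {z, y})"
    by (simp add: prod.reindex)
  ultimately have eq: "sub_poly S = sub_poly (S - {z}) * (\<Prod>y\<in>nbs z \<inter> S. edge_poly {z, y})"
    unfolding sub_poly_def by (simp add: prod.union_disjoint)
  have "(\<Prod>y\<in>nbs z \<inter> S. edge_poly {z, y}) = star z (nbs z \<inter> S) \<or>
        (\<Prod>y\<in>nbs z \<inter> S. edge_poly {z, y}) = - star z (nbs z \<inter> S)"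
    using assms nbs_irrefl by (intro star_edges) auto
  then show ?thesis
    unfolding eq by (auto simp: mult.commute)
qed

lemma sub_poly_free:
  assumes "finite S" "z \<notin> S"
  shows "var_free z (sub_poly S)"
proof -
  have fin: "finite {d. d \<in> D \<and> d \<subseteq> S}"
    using assms by (auto intro: finite_subset[of _ "Pow S"])
  have "var_free z (\<Prod>d\<in>F. edge_poly d)" if "F \<subseteq> {d. d \<in> D \<and> d \<subseteq> S}" "finite F" for F
    using that(2,1)
  proof (induction F rule: finite_induct)
    case empty
    then show ?case by (simp add: var_free_one)
  next
    case (insert d F)
    then have d: "d \<in> D" "d \<subseteq> S" by auto
    from edges[OF d(1)] obtain x y where xy: "x \<noteq> y" "d = {x, y}" by blast
    then have "x \<noteq> z" "y \<noteq> z" using d(2) assms by auto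
    moreover have "edge_poly d = var x - var y \<or> edge_poly d = var y - var x"
      using edge_poly_cases[OF xy(1)] xy(2) by auto
    ultimately show ?case
      using insert by (auto intro: var_free_diff_times)
  qed
  then show ?thesis using fin by (simp add: sub_poly_def)
qed

definition lin :: "'a set \<Rightarrow> ('a \<Rightarrow> real) \<Rightarrow> 'a mpol" where
  "lin S l = (\<Sum>y\<in>S. Poly_Mapping.single 0 (l y) * var y)"

text \<open>For finite \<open>S\<close> this says that the subgraph induced on \<open>S\<close> has
  Alon-Tarsi number at most \<open>k + 1\<close>.\<close>

definition good :: "nat \<Rightarrow> 'a set \<Rightarrow> bool" where
  "good k S \<longleftrightarrow> capped k (sub_poly S)"

text \<open>The state of an elimination in which one vertex has been taken one time fewer than its
  degree, so that a linear factor is still to be absorbed.\<close>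

definition lin_good :: "nat \<Rightarrow> 'a set \<Rightarrow> ('a \<Rightarrow> real) \<Rightarrow> bool" where
  "lin_good k S l \<longleftrightarrow> capped k (lin S l * sub_poly S)"

lemma good_empty: "good k {}"
  unfolding good_def capped_def sub_poly_empty
  by (rule exI[of _ 0]) (simp add: lookup_one)

lemma good_via_star:
  assumes "finite S" "z \<in> S" "capped k (star z (nbs z \<inter> S) * sub_poly (S - {z}))"
  shows "good k S"
  using sub_poly_remove[OF assms(1,2)] assms(3) by (auto simp: good_def)

lemma lin_good_via_star:
  assumes "finite S" "z \<in> S" "capped k (lin S l * (star z (nbs z \<inter> S) * sub_poly (S - {z})))"
  shows "lin_good k S l"
  using sub_poly_remove[OF assms(1,2)] assms(3) by (auto simp: lin_good_def)

text \<open>Take \<open>z\<close> to its full degree: the leading coefficient of the star is 1, so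
  exactly the polynomial of the remaining graph is left.\<close>

lemma good_remove:
  assumes "finite S" "z \<in> S" "card (nbs z \<inter> S) \<le> k" "good k (S - {z})"
  shows "good k S"
proof (rule good_via_star[OF assms(1,2)], rule capped_coef[OF _ assms(3)])
  show "capped k (coef z (card (nbs z \<inter> S)) (star z (nbs z \<inter> S) * sub_poly (S - {z})))"
    using assms nbs_irrefl by (subst coef_star_top) (auto simp: sub_poly_free good_def)
qed

text \<open>Here \<open>z\<close> has one neighbour too many. Taken only \<open>k\<close> times, it
  leaves the second coefficient of its star as a factor.\<close>

lemma good_from_lin:
  assumes "finite S" "z \<in> S" "card (nbs z \<inter> S) = Suc k"
    and "lin_good k (S - {z}) (\<lambda>y. if y \<in> nbs z then - 1 else 0)"
  shows "good k S"
proof (rule good_via_star[OF assms(1,2)], rule capped_coef[OF _ order_refl])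
  have "lin (S - {z}) (\<lambda>y. if y \<in> nbs z then - 1 else 0)
      = (\<Sum>y\<in>S - {z}. if y \<in> nbs z then - var y else 0)"
    unfolding lin_def by (intro sum.cong) (auto simp: single_uminus)
  also have "\<dots> = - (\<Sum>y\<in>nbs z \<inter> S. var y)"
  proof -
    have "(S - {z}) \<inter> nbs z = nbs z \<inter> S" using nbs_irrefl by auto
    then show ?thesis
      using assms(1) by (simp add: sum.inter_restrict[symmetric] sum_negf)
  qed
  finally show "capped k (coef z k (star z (nbs z \<inter> S) * sub_poly (S - {z})))"
    using assms nbs_irrefl by (subst coef_star_sub) (auto simp: sub_poly_free lin_good_def)
qed

lemma lin_remove:
  assumes "finite S" "z \<in> S"
  shows "lin S l * B = Poly_Mapping.single 0 (l z) * (var z * B) + lin (S - {z}) l * B"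
  unfolding lin_def using assms by (simp add: sum.remove distrib_right mult.assoc)

lemma coef_lin:
  assumes "z \<notin> T"
  shows "coef z d (lin T l * B) = lin T l * coef z d B"
  unfolding lin_def sum_distrib_right coef_sum
proof (rule sum.cong)
  fix y assume "y \<in> T"
  with assms have "z \<noteq> y" by auto
  then show "coef z d (Poly_Mapping.single 0 (l y) * var y * B) =
      Poly_Mapping.single 0 (l y) * var y * coef z d B"
    by (simp add: mult.assoc coef_const_times coef_var_other)
qed simp

text \<open>Take \<open>z\<close> to its full degree. The part of the form without \<open>z\<close>
  meets the leading coefficient of the star. The summand \<open>l z * z\<close> raises the degree by
  one and so meets the second coefficient, which subtracts \<open>l z\<close> at every
  neighbour.\<close>

lemma lin_good_remove:
  assumes "finite S" "z \<in> S" "card (nbs z \<inter> S) \<le> k"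
    and "lin_good k (S - {z}) (\<lambda>y. l y - (if y \<in> nbs z then l z else 0))"
  shows "lin_good k S l"
proof (rule lin_good_via_star[OF assms(1,2)], rule capped_coef[OF _ assms(3)])
  let ?Y = "nbs z \<inter> S" and ?A = "sub_poly (S - {z})"
  have Y: "finite ?Y" "z \<notin> ?Y" "var_free z ?A"
    using assms nbs_irrefl by (auto simp: sub_poly_free)
  have "coef z (card ?Y) (var z * (star z ?Y * ?A)) = - ((\<Sum>y\<in>?Y. var y) * ?A)"
  proof (cases "card ?Y")
    case 0
    then have "?Y = {}" using Y by simp
    then show ?thesis by (simp add: coef_0_var_same)
  next
    case (Suc d)
    then show ?thesis using Y by (simp add: coef_var_same coef_star_sub)
  qed
  then have "coef z (card ?Y) (lin S l * (star z ?Y * ?A)) =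
      (lin (S - {z}) l - Poly_Mapping.single 0 (l z) * (\<Sum>y\<in>?Y. var y)) * ?A"
    using Y assms(1,2)
    by (simp add: lin_remove coef_add coef_const_times coef_lin coef_star_top)
      (simp add: algebra_simps)
  also have "lin (S - {z}) l - Poly_Mapping.single 0 (l z) * (\<Sum>y\<in>?Y. var y) =
      lin (S - {z}) (\<lambda>y. l y - (if y \<in> nbs z then l z else 0))"
  proof -
    have "(S - {z}) \<inter> nbs z = ?Y" using nbs_irrefl by auto
    then have "Poly_Mapping.single 0 (l z) * (\<Sum>y\<in>?Y. var y) =
        (\<Sum>y\<in>S - {z}. if y \<in> nbs z then Poly_Mapping.single 0 (l z) * var y else 0)"
      using assms(1) by (simp add: sum.inter_restrict[symmetric] sum_distrib_left)
    then show ?thesis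
      unfolding lin_def
      by (simp add: sum_subtractf[symmetric]) (rule sum.cong, auto simp: single_diff left_diff_distrib)
  qed
  finally show "capped k (coef z (card ?Y) (lin S l * (star z ?Y * ?A)))"
    using assms(4) by (simp add: lin_good_def)
qed

text \<open>Take \<open>z\<close> one time more than its degree. Only \<open>l z * z\<close> times
  the leading term of the star reaches this power, so the form shrinks to the non-zero constant
  \<open>l z\<close>.\<close>

lemma lin_good_finish:
  assumes "finite S" "z \<in> S" "card (nbs z \<inter> S) < k" "l z \<noteq> 0" "good k (S - {z})"
  shows "lin_good k S l"
proof (rule lin_good_via_star[OF assms(1,2)], rule capped_coef)
  let ?Y = "nbs z \<inter> S" and ?A = "sub_poly (S - {z})"
  have Y: "finite ?Y" "z \<notin> ?Y" "var_free z ?A"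
    using assms nbs_irrefl by (auto simp: sub_poly_free)
  then have "coef z (Suc (card ?Y)) (lin S l * (star z ?Y * ?A)) = Poly_Mapping.single 0 (l z) * ?A"
    using assms(1,2)
    by (simp add: lin_remove coef_add coef_const_times coef_lin coef_var_same coef_star_top
        coef_star_gt)
  then show "capped k (coef z (Suc (card ?Y)) (lin S l * (star z ?Y * ?A)))"
    using assms(4,5) by (simp add: capped_const good_def)
  show "Suc (card ?Y) \<le> k" using assms(3) by simp
qed

lemma Alon_Tarsi_number_le:
  assumes "finite W" "\<Union>D \<subseteq> W" "good k W"
  shows "Alon_Tarsi_number W D \<le> Suc k"
proof -
  have "{d. d \<in> D \<and> d \<subseteq> W} = D" using assms(2) by auto
  then have "sub_poly W = graph_polynomial D"
    by (simp add: sub_poly_def graph_polynomial_def edge_poly_def)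
  with assms(3) obtain m where "Poly_Mapping.lookup (graph_polynomial D) m \<noteq> 0"
    "\<forall>w. Poly_Mapping.lookup m w \<le> k"
    unfolding good_def capped_def by auto
  then show ?thesis
    unfolding Alon_Tarsi_number_def by (intro Least_le exI[of _ m]) (auto simp: less_Suc_eq_le)
qed

end

section \<open>A Brooks-type argument for critical graphs\<close>

section \<open>Critical graphs\<close>

text \<open>The setting of a hypothetical counterexample: \<open>A\<close> can be eliminated,
  \<open>A\<close> together with \<open>B\<close> cannot. It is applied with the vertices of the
  plane graph as \<open>A\<close>, its edges as \<open>B\<close>, and \<open>k = 5\<close>.\<close>

locale critical_graph = finite_graph D for D :: "'a set set" +
  fixes A B :: "'a set" and k :: nat
  assumes finite_A: "finite A" and finite_B: "finite B"
    and disjoint: "A \<inter> B = {}"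
    and good_A: "good k A"
    and degree_le: "x \<in> B \<Longrightarrow> card (nbs x \<inter> (A \<union> B)) \<le> Suc k"
    and connected: "T \<subseteq> B \<Longrightarrow> T \<noteq> {} \<Longrightarrow> T \<noteq> B \<Longrightarrow> \<exists>x\<in>T. \<exists>y\<in>B - T. y \<in> nbs x"
    and not_good: "\<not> good k (A \<union> B)"
begin

text \<open>By connectedness some element of a nonempty \<open>T\<close> has a neighbour in
  \<open>B - T\<close>. Inside \<open>A\<close> and \<open>T\<close> its degree has dropped to at
  most \<open>k\<close>, so it can be eliminated first.\<close>

lemma good_proper:
  assumes "T \<subset> B"
  shows "good k (A \<union> T)"
  using finite_subset[OF psubset_imp_subset[OF assms] finite_B] assms
proof (induction T rule: finite_psubset_induct)
  case (psubset T)
  show ?case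
  proof (cases "T = {}")
    case True
    then show ?thesis using good_A by simp
  next
    case False
    then obtain x y where xy: "x \<in> T" "y \<in> B - T" "y \<in> nbs x"
      using connected[of T] psubset.prems by blast
    have "good k (A \<union> (T - {x}))"
      using psubset.IH[of "T - {x}"] psubset.prems xy by blast
    moreover have "A \<union> T - {x} = A \<union> (T - {x})"
      using xy psubset.prems disjoint by auto
    moreover have "nbs x \<inter> (A \<union> T) \<subset> nbs x \<inter> (A \<union> B)"
      using xy psubset.prems disjoint by auto
    then have "card (nbs x \<inter> (A \<union> T)) < card (nbs x \<inter> (A \<union> B))"
      using finite_A finite_B by (intro psubset_card_mono) auto
    then have "card (nbs x \<inter> (A \<union> T)) \<le> k"
      using degree_le[of x] xy psubset.prems by auto
    ultimately show ?thesis
      using good_remove[of "A \<union> T" x k] finite_A psubset.hyps xy by auto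
  qed
qed

text \<open>An element of smaller degree could be eliminated first, and \<open>good_proper\<close>
  would deal with the rest.\<close>

lemma degree_eq:
  assumes "x \<in> B"
  shows "card (nbs x \<inter> (A \<union> B)) = Suc k"
proof (rule ccontr)
  assume "card (nbs x \<inter> (A \<union> B)) \<noteq> Suc k"
  then have "card (nbs x \<inter> (A \<union> B)) \<le> k" using degree_le[OF assms] by simp
  moreover have "A \<union> B - {x} = A \<union> (B - {x})" using assms disjoint by auto
  ultimately show False
    using good_remove[of "A \<union> B" x k] good_proper[of "B - {x}"] assms finite_A finite_B not_good
    by auto
qed

text \<open>
  \<open>reach R s\<close> describes an elimination of the elements of \<open>R\<close> in which the first one is used one
  time fewer than its degree. What remains of the graph polynomial is multiplied by the linear form
  whose coefficient at \<open>y\<close> is minus the sum of \<open>s\<close> over the eliminated neighbours of \<open>y\<close>.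
\<close>

inductive reach :: "'a set \<Rightarrow> ('a \<Rightarrow> real) \<Rightarrow> bool" where
  start: "z \<in> B \<Longrightarrow> reach {z} (\<lambda>_. 1)"
| step: "reach R s \<Longrightarrow> z \<in> B - R \<Longrightarrow> nbs z \<inter> R \<noteq> {} \<Longrightarrow>
     reach (insert z R) (s(z := - (\<Sum>r\<in>nbs z \<inter> R. s r)))"

lemma reach_subset: "reach R s \<Longrightarrow> R \<subseteq> B \<and> R \<noteq> {}"
  by (induction rule: reach.induct) auto

text \<open>If the remainder could be completed, undoing the elimination would make the whole graph
  good: \<open>good_from_lin\<close> for the first element, \<open>lin_good_remove\<close> for the
  others. Each of the latter has a neighbour in \<open>R\<close>, hence at most \<open>k\<close>
  remaining ones.\<close>

lemma reach_not_lin_good: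
  assumes "reach R s"
  shows "\<not> lin_good k (A \<union> (B - R)) (\<lambda>y. - (\<Sum>r\<in>nbs y \<inter> R. s r))"
  using assms
proof (induction rule: reach.induct)
  case (start z)
  have "(\<lambda>y. - (\<Sum>r\<in>nbs y \<inter> {z}. 1 :: real)) = (\<lambda>y. if y \<in> nbs z then - 1 else 0)"
  proof
    fix y
    have "nbs y \<inter> {z} = (if y \<in> nbs z then {z} else {})" using nbs_sym by auto
    then show "- (\<Sum>r\<in>nbs y \<inter> {z}. 1 :: real) = (if y \<in> nbs z then - 1 else 0)" by simp
  qed
  moreover have "A \<union> B - {z} = A \<union> (B - {z})" using start disjoint by auto
  ultimately show ?case
    using good_from_lin[of "A \<union> B" z k] degree_eq[OF start] start finite_A finite_B not_good by auto
next
  case (step R s z)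
  let ?l = "\<lambda>y. - (\<Sum>r\<in>nbs y \<inter> R. s r)" and ?s = "s(z := - (\<Sum>r\<in>nbs z \<inter> R. s r))"
  have R: "finite R" "R \<subseteq> B" using reach_subset[OF step.hyps(1)] finite_B finite_subset by auto
  have "(\<lambda>y. - (\<Sum>r\<in>nbs y \<inter> insert z R. ?s r)) = (\<lambda>y. ?l y - (if y \<in> nbs z then ?l z else 0))"
  proof
    fix y
    have s: "(\<Sum>r\<in>nbs y \<inter> R. ?s r) = (\<Sum>r\<in>nbs y \<inter> R. s r)"
      using step.hyps by (intro sum.cong) auto
    show "- (\<Sum>r\<in>nbs y \<inter> insert z R. ?s r) = ?l y - (if y \<in> nbs z then ?l z else 0)"
    proof (cases "y \<in> nbs z")
      case True
      then have "nbs y \<inter> insert z R = insert z (nbs y \<inter> R)" using nbs_sym by auto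
      moreover have "z \<notin> nbs y \<inter> R" using step.hyps by auto
      ultimately show ?thesis using True s R by simp
    next
      case False
      then have "nbs y \<inter> insert z R = nbs y \<inter> R" using nbs_sym by auto
      then show ?thesis using False s by simp
    qed
  qed
  moreover have "A \<union> (B - R) - {z} = A \<union> (B - insert z R)" using step.hyps disjoint by auto
  moreover have "nbs z \<inter> (A \<union> (B - R)) \<subset> nbs z \<inter> (A \<union> B)" using step.hyps R disjoint by auto
  then have "card (nbs z \<inter> (A \<union> (B - R))) < card (nbs z \<inter> (A \<union> B))"
    using finite_A finite_B by (intro psubset_card_mono) auto
  then have "card (nbs z \<inter> (A \<union> (B - R))) \<le> k"
    using degree_le[of z] step.hyps by auto
  ultimately show ?case
    using lin_good_remove[of "A \<union> (B - R)" z k ?l] step finite_A finite_B by auto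
qed

text \<open>With two neighbours in \<open>R\<close>, \<open>z\<close> has at most
  \<open>k - 1\<close> remaining ones. A non-zero coefficient at \<open>z\<close> would then absorb
  the form by \<open>lin_good_finish\<close>, and what remains is good by
  \<open>good_proper\<close>.\<close>

lemma reach_sum_eq_0:
  assumes "reach R s" "z \<in> B - R" "2 \<le> card (nbs z \<inter> R)"
  shows "(\<Sum>r\<in>nbs z \<inter> R. s r) = 0"
proof (rule ccontr)
  assume neq: "(\<Sum>r\<in>nbs z \<inter> R. s r) \<noteq> 0"
  have R: "R \<subseteq> B" "R \<noteq> {}" using reach_subset[OF assms(1)] by auto
  have "good k (A \<union> (B - insert z R))" using R assms by (intro good_proper) auto
  moreover have "A \<union> (B - R) - {z} = A \<union> (B - insert z R)" using assms disjoint by auto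
  moreover have "card (nbs z \<inter> (A \<union> (B - R))) < k"
  proof -
    have "nbs z \<inter> (A \<union> B) = nbs z \<inter> (A \<union> (B - R)) \<union> nbs z \<inter> R" using R by auto
    moreover have "nbs z \<inter> (A \<union> (B - R)) \<inter> (nbs z \<inter> R) = {}" using R disjoint by auto
    ultimately have "card (nbs z \<inter> (A \<union> B)) = card (nbs z \<inter> (A \<union> (B - R))) + card (nbs z \<inter> R)"
      using finite_A finite_B finite_subset[OF R(1)] by (simp add: card_Un_disjoint)
    then show ?thesis using degree_eq[of z] assms by auto
  qed
  ultimately have "lin_good k (A \<union> (B - R)) (\<lambda>y. - (\<Sum>r\<in>nbs y \<inter> R. s r))"
    using lin_good_finish[of "A \<union> (B - R)" z k "\<lambda>y. - (\<Sum>r\<in>nbs y \<inter> R. s r)"] neq assms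
      finite_A finite_B by auto
  then show False using reach_not_lin_good[OF assms(1)] by contradiction
qed

text \<open>A periodic sequence can be started at any index. Two indices less than \<open>n\<close>
  apart stand for two different vertices, adjacent only when consecutive around the cycle.\<close>

definition induced_cycle :: "nat \<Rightarrow> (nat \<Rightarrow> 'a) \<Rightarrow> bool" where
  "induced_cycle n c \<longleftrightarrow> 3 \<le> n \<and> (\<forall>i. c (i + n) = c i) \<and> range c \<subseteq> B \<and>
     (\<forall>i j. i < j \<and> j < i + n \<longrightarrow> c i \<noteq> c j \<and> (c j \<in> nbs (c i) \<longleftrightarrow> j = i + 1 \<or> j = i + n - 1))"

lemma induced_cycle_inj:
  assumes "induced_cycle n c"
  shows "inj_on (\<lambda>i. c (p + i)) {..<n}"
proof (rule linorder_inj_onI')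
  fix i j assume "i \<in> {..<n}" "j \<in> {..<n}" "i < j"
  then show "c (p + i) \<noteq> c (p + j)"
    using assms unfolding induced_cycle_def by auto
qed

lemma induced_cycle_range:
  assumes "induced_cycle n c"
  shows "range c = (\<lambda>i. c (p + i)) ` {..<n}"
proof
  have per: "c (i + m * n) = c i" for i m
    using assms by (induction m) (auto simp: induced_cycle_def add.assoc[symmetric] add.commute[of n])
  have n: "0 < n" using assms by (auto simp: induced_cycle_def)
  show "range c \<subseteq> (\<lambda>i. c (p + i)) ` {..<n}"
  proof
    fix x assume "x \<in> range c"
    then obtain i where x: "x = c i" by auto
    \<comment> \<open>Adding \<open>p\<close> periods keeps the truncated subtraction of
      \<open>p\<close> exact.\<close>
    define q where "q = i + p * n - p"
    have "p \<le> p * n" using n by simp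
    then have "p \<le> i + p * n" by (rule trans_le_add2)
    then have "i + p * n = p + q" unfolding q_def by (rule le_add_diff_inverse[symmetric])
    also have "\<dots> = p + q mod n + q div n * n" by simp
    finally have "c i = c (p + q mod n)" using per by metis
    then show "x \<in> (\<lambda>i. c (p + i)) ` {..<n}" using x n by auto
  qed
qed auto

text \<open>Each new vertex sees only its predecessor among the eliminated ones, so it receives the
  negative of its value. This stops one vertex before the cycle closes, because the last vertex also
  sees the first.\<close>

lemma induced_path_reach:
  assumes "induced_cycle n c" "m + 1 < n"
  shows "\<exists>s. reach ((\<lambda>i. c (p + i)) ` {..m}) s \<and> (\<forall>i\<le>m. s (c (p + i)) = (- 1) ^ i)"
  using assms(2)
proof (induction m)
  case 0
  have "reach {c (p + 0)} (\<lambda>_. 1)"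
    by (rule start) (use assms in \<open>auto simp: induced_cycle_def\<close>)
  then show ?case by auto
next
  case (Suc m)
  let ?R = "(\<lambda>i. c (p + i)) ` {..m}" and ?z = "c (p + Suc m)"
  obtain s where s: "reach ?R s" "\<forall>i\<le>m. s (c (p + i)) = (- 1) ^ i"
    using Suc by auto
  have z: "?z \<noteq> c (p + i)" "?z \<in> nbs (c (p + i)) \<longleftrightarrow> i = m" if "i \<le> m" for i
  proof -
    have "p + i < p + Suc m" "p + Suc m < p + i + n" "p + Suc m \<noteq> p + i + n - 1"
      "p + Suc m = p + i + 1 \<longleftrightarrow> i = m"
      using Suc.prems that by auto
    then show "?z \<noteq> c (p + i)" "?z \<in> nbs (c (p + i)) \<longleftrightarrow> i = m"
      using assms(1) unfolding induced_cycle_def by metis+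
  qed
  then have nb: "nbs ?z \<inter> ?R = {c (p + m)}" using nbs_sym by auto
  have "reach (insert ?z ?R) (s(?z := - (\<Sum>r\<in>nbs ?z \<inter> ?R. s r)))"
    using s(1) by (rule step) (use assms z nb in \<open>auto simp: induced_cycle_def\<close>)
  moreover have "insert ?z ?R = (\<lambda>i. c (p + i)) ` {..Suc m}" by (simp add: atMost_Suc)
  moreover have "(s(?z := - (\<Sum>r\<in>nbs ?z \<inter> ?R. s r))) (c (p + i)) = (- 1) ^ i" if "i \<le> Suc m" for i
  proof (cases "i = Suc m")
    case True
    then show ?thesis using nb s(2) by simp
  next
    case False
    then have "i \<le> m" using that by simp
    then show ?thesis using z(1)[of i] s(2) by auto
  qed
  ultimately show ?case by metis
qed

text \<open>The closing vertex sees both ends of the path, whose values 1 and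
  \<open>(- 1) ^ (n - 2)\<close> must cancel by \<open>reach_sum_eq_0\<close>. So \<open>n\<close>
  is odd and the closing vertex gets 0. As \<open>p\<close> is free, the 0 can be placed at any
  vertex.\<close>

lemma induced_cycle_reach:
  assumes "induced_cycle n c"
  shows "odd n \<and> (\<exists>s. reach (range c) s \<and> (\<forall>i<n - 1. s (c (p + i)) = (- 1) ^ i) \<and>
    s (c (p + (n - 1))) = 0)"
proof -
  have n: "3 \<le> n" using assms by (simp add: induced_cycle_def)
  let ?R = "(\<lambda>i. c (p + i)) ` {..n - 2}" and ?z = "c (p + (n - 1))"
  have "n - 2 + 1 < n" using n by simp
  from induced_path_reach[OF assms this]
  obtain s where s: "reach ?R s" "\<forall>i\<le>n - 2. s (c (p + i)) = (- 1) ^ i" by blast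
  have z: "?z \<noteq> c (p + i)" "?z \<in> nbs (c (p + i)) \<longleftrightarrow> i = 0 \<or> i = n - 2" if "i \<le> n - 2" for i
  proof -
    have "p + i < p + (n - 1)" "p + (n - 1) < p + i + n"
      "p + (n - 1) = p + i + 1 \<longleftrightarrow> i = n - 2"
      "p + (n - 1) = p + i + n - 1 \<longleftrightarrow> i = 0"
      using n that by auto
    then show "?z \<noteq> c (p + i)" "?z \<in> nbs (c (p + i)) \<longleftrightarrow> i = 0 \<or> i = n - 2"
      using assms unfolding induced_cycle_def by metis+
  qed
  have nb: "nbs ?z \<inter> ?R = {c (p + 0), c (p + (n - 2))}"
  proof -
    have "c (p + 0) \<in> ?R" "c (p + (n - 2)) \<in> ?R" by (rule imageI, simp)+
    then show ?thesis using z(2) z(2)[of 0] z(2)[of "n - 2"] nbs_sym by auto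
  qed
  have zR: "?z \<in> B - ?R" using assms z(1) by (auto simp: induced_cycle_def)
  have "inj_on (\<lambda>i. c (p + i)) {..<n}" by (rule induced_cycle_inj[OF assms])
  then have neq: "c (p + 0) \<noteq> c (p + (n - 2))" using n by (subst inj_on_eq_iff) auto
  have sum: "(\<Sum>r\<in>nbs ?z \<inter> ?R. s r) = 0"
    using s(1) zR by (rule reach_sum_eq_0) (simp only: nb, use neq in simp)
  have "s (c (p + 0)) + s (c (p + (n - 2))) = 0"
    using sum neq unfolding nb by simp
  moreover have "s (c (p + 0)) = 1" "s (c (p + (n - 2))) = (- 1) ^ (n - 2)"
    using s(2)[rule_format, of 0] s(2)[rule_format, of "n - 2"] by auto
  ultimately have "(- 1) ^ (n - 2) = (- 1 :: real)" by simp
  then have odd: "odd n" using n by (cases "even n") auto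
  have "reach (insert ?z ?R) (s(?z := - (\<Sum>r\<in>nbs ?z \<inter> ?R. s r)))"
    using s(1) zR by (rule step) (simp only: nb, simp)
  moreover have "insert ?z ?R = range c"
  proof -
    have "{..<n} = insert (n - 1) {..n - 2}" using n by auto
    then show ?thesis by (simp add: induced_cycle_range[OF assms, of p])
  qed
  moreover have "(s(?z := - (\<Sum>r\<in>nbs ?z \<inter> ?R. s r))) (c (p + i)) = (- 1) ^ i" if "i < n - 1" for i
  proof -
    have "i \<le> n - 2" using that by simp
    then show ?thesis using z(1)[of i] s(2) by auto
  qed
  moreover have "(s(?z := - (\<Sum>r\<in>nbs ?z \<inter> ?R. s r))) ?z = 0" using sum by simp
  ultimately show ?thesis using odd by metis
qed

text \<open>For every starting index the alternating sum of the neighbours of \<open>z\<close> along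
  the cycle, without the closing vertex, is 0. Comparing two consecutive starting indices shows that
  being a neighbour of \<open>z\<close> does not change along the cycle.\<close>

lemma adjacent_to_induced_cycle:
  assumes c: "induced_cycle n c" and z: "z \<in> B - range c" "2 \<le> card (nbs z \<inter> range c)"
  shows "range c \<subseteq> nbs z"
proof -
  define hit where "hit j = (if c j \<in> nbs z then 1 else 0 :: real)" for j
  have n: "3 \<le> n" "odd n"
    using c induced_cycle_reach[OF c] by (auto simp: induced_cycle_def)
  have sum0: "(\<Sum>i<n - 1. hit (p + i) * (- 1) ^ i) = 0" for p
  proof -
    obtain s where s: "reach (range c) s" "\<forall>i<n - 1. s (c (p + i)) = (- 1) ^ i"
      "s (c (p + (n - 1))) = 0"
      using induced_cycle_reach[OF c, of p] by auto
    have "0 = (\<Sum>r\<in>nbs z \<inter> range c. s r)" using reach_sum_eq_0[OF s(1) z] by simp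
    also have "\<dots> = (\<Sum>r\<in>range c. if r \<in> nbs z then s r else 0)"
      by (subst Int_commute, rule sum.inter_restrict)
        (use c finite_B in \<open>auto simp: induced_cycle_def intro: finite_subset\<close>)
    also have "\<dots> = (\<Sum>i<n. if c (p + i) \<in> nbs z then s (c (p + i)) else 0)"
      unfolding induced_cycle_range[OF c, of p]
      using induced_cycle_inj[OF c, of p] by (simp add: sum.reindex)
    \<comment> \<open>The closing vertex carries the value 0 and drops out.\<close>
    also have "{..<n} = insert (n - 1) {..<n - 1}" using n by auto
    also have "(\<Sum>i\<in>insert (n - 1) {..<n - 1}. if c (p + i) \<in> nbs z then s (c (p + i)) else 0) =
        (\<Sum>i<n - 1. hit (p + i) * (- 1) ^ i)"
      using s by (simp add: hit_def) (rule sum.cong, auto)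
    finally show ?thesis by simp
  qed
  obtain m where m: "n = Suc (Suc m)" using n(1) by (cases n; cases "n - 1") auto
  \<comment> \<open>The sums for \<open>p\<close> and \<open>Suc p\<close> overlap in all but one
    term each, with opposite signs; the last sign is known because \<open>m\<close> is odd.\<close>
  have shift: "hit p = hit (Suc p + m)" for p
  proof -
    have "(\<Sum>i<Suc m. hit (Suc p + i) * (- 1) ^ i) = 0" "(\<Sum>i<Suc m. hit (p + i) * (- 1) ^ i) = 0"
      using sum0[of p] sum0[of "Suc p"] m by auto
    moreover have "(\<Sum>i<Suc m. hit (p + i) * (- 1) ^ i) =
        hit p - (\<Sum>i<m. hit (Suc p + i) * (- 1) ^ i)"
      by (subst sum.lessThan_Suc_shift) (simp add: sum_negf)
    moreover have "odd m" using m n by simp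
    ultimately show ?thesis by simp
  qed
  \<comment> \<open>Since \<open>m = n - 2\<close>, shifting from \<open>Suc p\<close> leads to
    \<open>p + n\<close>, which is \<open>p\<close> again.\<close>
  have const: "hit (Suc p) = hit p" for p
  proof -
    have eq: "Suc (Suc p) + m = p + n" using m by simp
    have "c (p + n) = c p" using c by (simp add: induced_cycle_def)
    then show ?thesis using shift[of "Suc p"] unfolding eq hit_def by simp
  qed
  then have all: "hit p = hit 0" for p by (induction p) auto
  have "nbs z \<inter> range c \<noteq> {}" using z(2) by auto
  then obtain i where "c i \<in> nbs z" by auto
  then have "hit j = 1" for j using all[of i] all[of j] by (simp add: hit_def)
  then have "c j \<in> nbs z" for j unfolding hit_def by (metis zero_neq_one)
  then show ?thesis by auto
qed

text \<open>This replaces the path outside the cycle: whatever hangs on \<open>c 0\<close> off the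
  cycle cannot get back to another cycle vertex. \<open>K\<close> is what a largest elimination adds
  to the cycle while all new values are 0.\<close>

lemma separated_by_cycle_vertex:
  assumes c: "induced_cycle n c" and nall: "\<And>z. z \<in> B - range c \<Longrightarrow> \<not> range c \<subseteq> nbs z"
  obtains K where "K \<subseteq> B - range c" "\<And>x. x \<in> K \<Longrightarrow> nbs x \<inter> B \<subseteq> insert (c 0) K"
    "nbs (c 0) \<inter> B \<subseteq> K \<union> range c"
proof -
  let ?C = "range c"
  have n: "3 \<le> n" using c by (simp add: induced_cycle_def)
  \<comment> \<open>Besides the cycle, \<open>R\<close> contains only elements of value 0 that meet
    the cycle at most in \<open>c 0\<close>.\<close>
  define Q where "Q R \<longleftrightarrow> (\<exists>s. reach R s \<and> ?C \<subseteq> R \<and> (\<forall>x\<in>?C - {c 0}. s x \<noteq> 0) \<and>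
     (\<forall>x\<in>insert (c 0) (R - ?C). s x = 0) \<and> (\<forall>x\<in>R - ?C. nbs x \<inter> ?C \<subseteq> {c 0}))" for R
  have "Q ?C"
  proof -
    \<comment> \<open>Started at 1, the cycle closes at \<open>c n = c 0\<close>, which therefore
      gets the value 0.\<close>
    obtain s where s: "reach ?C s" "\<forall>i<n - 1. s (c (1 + i)) = (- 1) ^ i" "s (c (1 + (n - 1))) = 0"
      using induced_cycle_reach[OF c, of 1] by auto
    have "c (1 + (n - 1)) = c 0"
    proof -
      have "1 + (n - 1) = 0 + n" using n by simp
      then show ?thesis using c unfolding induced_cycle_def by metis
    qed
    moreover have "s x \<noteq> 0" if x: "x \<in> ?C - {c 0}" for x
    proof -
      obtain i where i: "i < n" "x = c (1 + i)"
        using x induced_cycle_range[OF c, of 1] by auto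
      with x calculation have "i \<noteq> n - 1" by auto
      with i have "i < n - 1" by simp
      then show ?thesis using s(2) i(2) by simp
    qed
    ultimately show ?thesis unfolding Q_def using s by auto
  qed
  moreover have "card R < Suc (card B)" if "Q R" for R
    using that reach_subset finite_B unfolding Q_def by (metis card_mono less_Suc_eq_le)
  ultimately obtain R where R: "Q R" and max: "\<And>R'. Q R' \<Longrightarrow> card R' \<le> card R"
    using ex_has_greatest_nat[of Q ?C card "Suc (card B)"] by (metis less_imp_le)
  obtain s where s: "reach R s" "?C \<subseteq> R" "\<forall>x\<in>?C - {c 0}. s x \<noteq> 0"
    "\<forall>x\<in>insert (c 0) (R - ?C). s x = 0" "\<forall>x\<in>R - ?C. nbs x \<inter> ?C \<subseteq> {c 0}"
    using R unfolding Q_def by auto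
  have fin: "R \<subseteq> B" "finite R" using reach_subset[OF s(1)] finite_B finite_subset by auto
  \<comment> \<open>If \<open>z\<close> saw an element of value 0 and no cycle vertex other than
    \<open>c 0\<close>, it would receive 0 and could be added to \<open>R\<close>. If it also saw
    another cycle vertex \<open>x\<close>, then \<open>x\<close> would be its only neighbour of
    non-zero value, against \<open>reach_sum_eq_0\<close>.\<close>
  have away: "nbs z \<inter> insert (c 0) (R - ?C) = {}" if z: "z \<in> B - R" for z
  proof (rule ccontr)
    assume "nbs z \<inter> insert (c 0) (R - ?C) \<noteq> {}"
    then obtain y where y: "y \<in> nbs z" "y \<in> insert (c 0) (R - ?C)" by blast
    have yR: "y \<in> R" using y s(2) by auto
    show False
    proof (cases "nbs z \<inter> ?C \<subseteq> {c 0}")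
      case True
      have sum: "(\<Sum>r\<in>nbs z \<inter> R. s r) = 0"
        using True s(4) by (intro sum.neutral) auto
      have "reach (insert z R) (s(z := - (\<Sum>r\<in>nbs z \<inter> R. s r)))"
        using s(1) z by (rule step) (use y yR in auto)
      moreover have "\<forall>x\<in>insert z R - ?C. nbs x \<inter> ?C \<subseteq> {c 0}"
        using s(5) True by blast
      ultimately have "Q (insert z R)"
        unfolding Q_def using s(2-4) z sum
        by (intro exI[of _ "s(z := - (\<Sum>r\<in>nbs z \<inter> R. s r))"]) auto
      from max[OF this] show False using z fin by simp
    next
      case False
      then obtain x where x: "x \<in> nbs z" "x \<in> ?C" "x \<noteq> c 0" by auto
      have xR: "x \<in> R" and xy: "x \<noteq> y" using x y s(2) by auto
      have "card {x, y} \<le> card (nbs z \<inter> R)"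
        using x y xR yR fin by (intro card_mono) auto
      then have sum: "(\<Sum>r\<in>nbs z \<inter> R. s r) = 0"
        using s(1) z xy by (intro reach_sum_eq_0) auto
      have "\<not> 2 \<le> card (nbs z \<inter> ?C)"
        using adjacent_to_induced_cycle[OF c, of z] nall[of z] z s(2) by auto
      moreover have "finite (nbs z \<inter> ?C)" using fin s(2) finite_subset by blast
      ultimately have single: "nbs z \<inter> ?C = {x}"
        using x card_le_Suc0_iff_eq[of "nbs z \<inter> ?C"] by auto
      have "(\<Sum>r\<in>nbs z \<inter> R. s r) = (\<Sum>r\<in>{x}. s r)"
        using x xR fin s(4) single by (intro sum.mono_neutral_right) auto
      with sum x s(3) show False by auto
    qed
  qed
  show ?thesis
  proof (rule that[of "R - ?C"])
    show "R - ?C \<subseteq> B - ?C" using fin by auto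
    show "nbs x \<inter> B \<subseteq> insert (c 0) (R - ?C)" if "x \<in> R - ?C" for x
    proof
      fix w assume w: "w \<in> nbs x \<inter> B"
      then have "w \<in> R" using away[of w] that nbs_sym by auto
      then show "w \<in> insert (c 0) (R - ?C)" using s(5) that w by auto
    qed
    show "nbs (c 0) \<inter> B \<subseteq> R - ?C \<union> ?C"
      using away nbs_sym by blast
  qed
qed

end

section \<open>Cycles, boundaries modulo 2 and facial adjacency\<close>

section \<open>Graphs with a double cover by face cycles\<close>

locale simple_graph =
  fixes V :: "'v set" and E :: "'e set" and ends :: "'e \<Rightarrow> 'v set"
  assumes finite_V: "finite V" and finite_E: "finite E"
    and ends: "e \<in> E \<Longrightarrow> \<exists>u v. u \<noteq> v \<and> u \<in> V \<and> v \<in> V \<and> ends e = {u, v}"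
    and inj_ends: "inj_on ends E"
begin

definition cyc :: "nat \<Rightarrow> (nat \<Rightarrow> 'v) \<Rightarrow> (nat \<Rightarrow> 'e) \<Rightarrow> bool" where
  "cyc n v c \<longleftrightarrow> 3 \<le> n \<and> (\<forall>i. v (i + n) = v i) \<and> (\<forall>i. c (i + n) = c i) \<and>
     (\<forall>i j. i < j \<and> j < i + n \<longrightarrow> v i \<noteq> v j) \<and>
     (\<forall>i. c i \<in> E \<and> ends (c i) = {v i, v (Suc i)})"

lemma ends_eqD: "e \<in> E \<Longrightarrow> f \<in> E \<Longrightarrow> ends e = ends f \<Longrightarrow> e = f"
  using inj_ends by (simp add: inj_on_def)

lemma card_ends: "e \<in> E \<Longrightarrow> card (ends e) = 2"
  using ends[of e] by auto

lemma ends_subset: "e \<in> E \<Longrightarrow> ends e \<subseteq> V"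
  using ends[of e] by auto

context
  fixes n v c
  assumes cyc: "cyc n v c"
begin

lemma cyc_v_neq: "i < j \<Longrightarrow> j < i + n \<Longrightarrow> v i \<noteq> v j"
  using cyc by (auto simp: cyc_def)

lemma cyc_period: "v (i + n) = v i" "c (i + n) = c i"
  using cyc by (auto simp: cyc_def)

lemma cyc_edge: "c i \<in> E" "ends (c i) = {v i, v (Suc i)}" and cyc_ge_3: "3 \<le> n"
  using cyc by (auto simp: cyc_def)

text \<open>Equal edges with different first vertices would be traversed in opposite directions;
  this forces \<open>j = i + 1\<close> and then a period of 2.\<close>

lemma cyc_c_neq:
  assumes "i < j" "j < i + n"
  shows "c i \<noteq> c j"
proof
  assume "c i = c j"
  then have "{v i, v (Suc i)} = {v j, v (Suc j)}" using cyc_edge(2) by metis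
  moreover have "v i \<noteq> v j" using assms by (rule cyc_v_neq)
  ultimately have eq: "v i = v (Suc j)" "v (Suc i) = v j" by (auto simp: doubleton_eq_iff)
  have "\<not> Suc i < j" using cyc_v_neq[of "Suc i" j] eq assms by auto
  then have "j = Suc i" using assms by simp
  then show False using cyc_v_neq[of i "Suc j"] eq cyc_ge_3 by simp
qed

lemma cyc_shift: "v (p + i) = v (p + i mod n)" "c (p + i) = c (p + i mod n)"
proof -
  have "v (p + j + m * n) = v (p + j)" "c (p + j + m * n) = c (p + j)" for j m
  proof (induction m)
    case (Suc m)
    have "p + j + Suc m * n = p + j + m * n + n" by simp
    with Suc show "v (p + j + Suc m * n) = v (p + j)" "c (p + j + Suc m * n) = c (p + j)"
      using cyc_period by metis+
  qed auto
  note this[of "i mod n" "i div n"]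
  then show "v (p + i) = v (p + i mod n)" "c (p + i) = c (p + i mod n)"
    by (simp_all only: add.assoc mod_div_mult_eq)
qed

lemma cyc_index:
  obtains j where "p \<le> j" "j < p + n" "v i = v j" "c i = c j"
proof -
  define q where "q = i + p * n - p"
  have "p \<le> p * n" using cyc_ge_3 by simp
  then have "p \<le> i + p * n" by (rule trans_le_add2)
  then have q: "i + p * n = p + q" unfolding q_def by (rule le_add_diff_inverse[symmetric])
  have "v (i + p * n) = v (i + p * n mod n)" "c (i + p * n) = c (i + p * n mod n)"
    by (rule cyc_shift)+
  then have "v i = v (p + q mod n)" "c i = c (p + q mod n)"
    using cyc_shift[of p q] q by auto
  moreover have "q mod n < n" using cyc_ge_3 by simp
  ultimately show ?thesis using that[of "p + q mod n"] by simp
qed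

lemma cyc_edges_at:
  shows "{e \<in> range c. v (Suc i) \<in> ends e} = {c i, c (Suc i)}"
proof
  show "{e \<in> range c. v (Suc i) \<in> ends e} \<subseteq> {c i, c (Suc i)}"
  proof
    fix e assume "e \<in> {e \<in> range c. v (Suc i) \<in> ends e}"
    then obtain k where k: "e = c k" "v (Suc i) \<in> ends (c k)" by auto
    obtain j where j: "i \<le> j" "j < i + n" "c k = c j" using cyc_index[of i k] by metis
    then have "v (Suc i) = v j \<or> v (Suc i) = v (Suc j)" using k cyc_edge(2)[of j] by auto
    moreover have "j = Suc i" if "v (Suc i) = v j" "j \<noteq> i"
    proof (rule ccontr)
      assume "j \<noteq> Suc i"
      then have "Suc i < j" using that j by simp
      then show False using cyc_v_neq[of "Suc i" j] j that by simp
    qed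
    moreover have "j = i" if "v (Suc i) = v (Suc j)"
      using cyc_v_neq[of "Suc i" "Suc j"] j that by (cases "i = j") auto
    ultimately show "e \<in> {c i, c (Suc i)}" using k j by auto
  qed
  show "{c i, c (Suc i)} \<subseteq> {e \<in> range c. v (Suc i) \<in> ends e}"
    using cyc_edge(2) by auto
qed

lemma even_card_cyc_edges_at: "even (card {e \<in> range c. x \<in> ends e})"
proof (cases "\<exists>e\<in>range c. x \<in> ends e")
  case True
  then obtain j where "x \<in> ends (c j)" by auto
  then have "x = v j \<or> x = v (Suc j)" using cyc_edge(2) by auto
  moreover have "v j = v (Suc (j + n - 1))" using cyc_period(1)[of j] cyc_ge_3 by simp
  ultimately obtain i where "x = v (Suc i)" by metis
  moreover have "c i \<noteq> c (Suc i)" using cyc_c_neq[of i "Suc i"] cyc_ge_3 by simp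
  ultimately show ?thesis by (simp add: cyc_edges_at)
next
  case False
  then have "{e \<in> range c. x \<in> ends e} = {}" by auto
  then show ?thesis by (simp only: card.empty) simp
qed

text \<open>Stated in the index form of \<open>induced_cycle\<close>, into which it is translated
  for the edges of a face.\<close>

lemma cyc_consecutive:
  assumes "i < j" "j < i + n"
  shows "ends (c i) \<inter> ends (c j) \<noteq> {} \<longleftrightarrow> j = i + 1 \<or> j = i + n - 1"
proof
  assume "ends (c i) \<inter> ends (c j) \<noteq> {}"
  then obtain x where x: "x \<in> {v i, v (Suc i)}" "x \<in> {v j, v (Suc j)}"
    using cyc_edge(2) by auto
  have "v i \<noteq> v j" "v (Suc i) \<noteq> v (Suc j)"
    using assms cyc_v_neq[of i j] cyc_v_neq[of "Suc i" "Suc j"] by auto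
  then have "v i = v (Suc j) \<or> v (Suc i) = v j" using x by auto
  then show "j = i + 1 \<or> j = i + n - 1"
  proof
    assume "v i = v (Suc j)"
    then have "\<not> Suc j < i + n" using assms cyc_v_neq[of i "Suc j"] by auto
    then show ?thesis using assms by auto
  next
    assume "v (Suc i) = v j"
    then have "\<not> Suc i < j" using assms cyc_v_neq[of "Suc i" j] by auto
    then show ?thesis using assms by auto
  qed
next
  assume "j = i + 1 \<or> j = i + n - 1"
  then show "ends (c i) \<inter> ends (c j) \<noteq> {}"
  proof
    assume "j = i + n - 1"
    then have "Suc j = i + n" using cyc_ge_3 by simp
    then have "v (Suc j) = v i" using cyc_period(1) by metis
    then show ?thesis using cyc_edge(2) by auto
  qed (use cyc_edge(2) in auto)
qed

end

end

locale graph_with_faces = simple_graph V E ends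
  for V :: "'v set" and E :: "'e set" and ends :: "'e \<Rightarrow> 'v set" +
  fixes Fs :: "'f set" and bd :: "'f \<Rightarrow> 'e set"
  assumes finite_Fs: "finite Fs"
    and two_faces: "e \<in> E \<Longrightarrow> card {F \<in> Fs. e \<in> bd F} = 2"
    and face_cyc: "F \<in> Fs \<Longrightarrow> \<exists>n v c. cyc n v c \<and> bd F = range c"
begin

text \<open>An edge lies on at most two faces of \<open>S\<close>, so this is the boundary modulo 2
  of a set of faces.\<close>

definition boundary :: "'f set \<Rightarrow> 'e set" where
  "boundary S = {e \<in> E. card {F \<in> S. e \<in> bd F} = 1}"

definition fadj :: "'e \<Rightarrow> 'e \<Rightarrow> bool" where
  "fadj e f \<longleftrightarrow> e \<noteq> f \<and> ends e \<inter> ends f \<noteq> {} \<and> (\<exists>F\<in>Fs. e \<in> bd F \<and> f \<in> bd F)"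

end

text \<open>The contribution of the plane: a combinatorial Jordan curve theorem, by which every
  cycle bounds a set of faces, and connectedness of the dual graph.\<close>

locale plane_faces = graph_with_faces V E ends Fs bd
  for V :: "'v set" and E :: "'e set" and ends :: "'e \<Rightarrow> 'v set"
    and Fs :: "'f set" and bd :: "'f \<Rightarrow> 'e set" +
  assumes cyc_boundary: "cyc n v c \<Longrightarrow> \<exists>S\<subseteq>Fs. boundary S = range c"
    and boundary_nonempty: "S \<subseteq> Fs \<Longrightarrow> S \<noteq> {} \<Longrightarrow> S \<noteq> Fs \<Longrightarrow> boundary S \<noteq> {}"
begin

lemma bd_subset: "F \<in> Fs \<Longrightarrow> bd F \<subseteq> E"
  using face_cyc[of F] cyc_edge(1) by fastforce

lemma card_faces_le: "S \<subseteq> Fs \<Longrightarrow> e \<in> E \<Longrightarrow> card {F \<in> S. e \<in> bd F} \<le> 2"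
  unfolding two_faces[symmetric] using finite_Fs by (intro card_mono) auto

text \<open>Count the pairs of a face in \<open>S\<close> and an edge of it at \<open>x\<close>.
  Every face contributes an even number, and modulo 2 only edges on exactly one face of
  \<open>S\<close> survive.\<close>

lemma even_boundary_at:
  assumes "S \<subseteq> Fs"
  shows "even (card {e \<in> boundary S. x \<in> ends e})"
proof -
  let ?X = "{e \<in> E. x \<in> ends e}" and ?n = "\<lambda>e. card {F \<in> S. e \<in> bd F}"
  have fin: "finite S" "finite ?X" using assms finite_subset finite_Fs finite_E by auto
  have "(\<Sum>e\<in>?X. ?n e) = (\<Sum>e\<in>?X. \<Sum>F\<in>S. if e \<in> bd F then 1 else 0)"
    using fin by (simp add: sum.inter_filter[symmetric])
  also have "\<dots> = (\<Sum>F\<in>S. \<Sum>e\<in>?X. if e \<in> bd F then 1 else 0)" by (rule sum.swap)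
  also have "\<dots> = (\<Sum>F\<in>S. card {e \<in> bd F. x \<in> ends e})"
  proof (rule sum.cong)
    fix F assume "F \<in> S"
    then have "{e \<in> ?X. e \<in> bd F} = {e \<in> bd F. x \<in> ends e}" using assms bd_subset by blast
    then show "(\<Sum>e\<in>?X. if e \<in> bd F then 1 else 0) = card {e \<in> bd F. x \<in> ends e}"
      using fin by (simp add: sum.inter_filter[symmetric])
  qed simp
  also have "even \<dots>"
  proof (rule dvd_sum)
    fix F assume "F \<in> S"
    then obtain n v c where c: "cyc n v c" "bd F = range c" using assms face_cyc by blast
    show "even (card {e \<in> bd F. x \<in> ends e})"
      unfolding c(2) by (rule even_card_cyc_edges_at[OF c(1)])
  qed
  finally have "even (card {e \<in> ?X. odd (?n e)})"
    using fin by (simp add: even_sum_iff)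
  moreover have "{e \<in> ?X. odd (?n e)} = {e \<in> boundary S. x \<in> ends e}"
  proof -
    have "odd (?n e) \<longleftrightarrow> ?n e = 1" if "e \<in> E" for e
      using card_faces_le[OF assms that] by (cases "?n e"; cases "?n e - 1") auto
    then show ?thesis unfolding boundary_def by auto
  qed
  ultimately show ?thesis by simp
qed

text \<open>By parity, each end of a boundary edge meets a further boundary edge. The two further
  edges differ, since otherwise they would be parallel to the first.\<close>

lemma card_boundary_ge_3:
  assumes "S \<subseteq> Fs" "boundary S \<noteq> {}"
  shows "3 \<le> card (boundary S)"
proof -
  have fin: "finite (boundary S)" using finite_E by (simp add: boundary_def)
  obtain e where e: "e \<in> boundary S" using assms by auto
  then have eE: "e \<in> E" by (simp add: boundary_def)
  have other: "\<exists>f\<in>boundary S. f \<noteq> e \<and> x \<in> ends f" if "x \<in> ends e" for x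
  proof (rule ccontr)
    assume "\<not> ?thesis"
    then have "{f \<in> boundary S. x \<in> ends f} = {e}" using e that by auto
    then show False using even_boundary_at[OF assms(1), of x] by simp
  qed
  obtain u v where uv: "u \<noteq> v" "ends e = {u, v}" using ends[OF eE] by blast
  obtain f where f: "f \<in> boundary S" "f \<noteq> e" "u \<in> ends f" using other[of u] uv by auto
  obtain g where g: "g \<in> boundary S" "g \<noteq> e" "v \<in> ends g" using other[of v] uv by auto
  have "f \<noteq> g"
  proof
    assume "f = g"
    then have "ends e \<subseteq> ends f" using f g uv by auto
    moreover have "f \<in> E" using f by (simp add: boundary_def)
    ultimately have "ends e = ends f"
      using card_ends eE by (metis card_subset_eq card.infinite zero_neq_numeral)
    then show False using ends_eqD \<open>f \<in> E\<close> eE f by auto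
  qed
  then have "card {e, f, g} = 3" using f g by auto
  moreover have "card {e, f, g} \<le> card (boundary S)" using e f g fin by (intro card_mono) auto
  ultimately show ?thesis by simp
qed

lemma boundary_faces: "S \<subseteq> Fs \<Longrightarrow> e \<in> boundary S \<Longrightarrow>
    \<exists>F\<in>S. \<exists>F'\<in>Fs - S. {F \<in> Fs. e \<in> bd F} = {F, F'}"
proof -
  assume S: "S \<subseteq> Fs" and e: "e \<in> boundary S"
  then have eE: "e \<in> E" and "card {F \<in> S. e \<in> bd F} = 1" by (auto simp: boundary_def)
  then obtain F where F: "{F \<in> S. e \<in> bd F} = {F}" by (auto simp: card_1_singleton_iff)
  obtain G H where GH: "{F \<in> Fs. e \<in> bd F} = {G, H}" "G \<noteq> H"
    using two_faces[OF eE] by (auto simp: card_2_iff)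
  have "{G, H} \<inter> S = {F}" using F GH(1) S by auto
  then have "F = G \<and> H \<notin> S \<or> F = H \<and> G \<notin> S"
    using GH(2) by (cases "G \<in> S"; cases "H \<in> S") auto
  then consider "F = G" "H \<notin> S" | "F = H" "G \<notin> S" by blast
  then show ?thesis
    using F GH S by cases (metis (no_types, lifting) DiffI insertCI insert_commute mem_Collect_eq)+
qed

lemma not_boundary_same:
  assumes "S \<subseteq> Fs" "e \<in> E" "e \<notin> boundary S" "F \<in> Fs" "F' \<in> Fs" "e \<in> bd F" "e \<in> bd F'"
  shows "F \<in> S \<longleftrightarrow> F' \<in> S"
proof (cases "F = F'")
  case False
  have "{F, F'} = {F \<in> Fs. e \<in> bd F}"
    using assms False two_faces[OF assms(2)] finite_Fs
    by (intro card_subset_eq) auto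
  then have "{F \<in> S. e \<in> bd F} = {F, F'} \<inter> S" using assms(1) by auto
  moreover have "card {F \<in> S. e \<in> bd F} \<noteq> 1" using assms by (auto simp: boundary_def)
  ultimately show ?thesis using False by (cases "F \<in> S"; cases "F' \<in> S") auto
qed simp

lemma fadj_sym: "fadj e f \<longleftrightarrow> fadj f e"
  unfolding fadj_def by blast

lemma fadj_cyc:
  assumes "cyc n v c" "F \<in> Fs" "bd F = range c" "i < j" "j < i + n"
  shows "fadj (c i) (c j) \<longleftrightarrow> j = i + 1 \<or> j = i + n - 1"
  using cyc_consecutive[OF assms(1,4,5)] cyc_c_neq[OF assms(1,4,5)] assms(2,3)
  unfolding fadj_def by auto

lemma edges_at_face:
  assumes "F \<in> Fs" "e \<in> bd F" "x \<in> ends e"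
  obtains f where "{g \<in> bd F. x \<in> ends g} = {e, f}" "f \<noteq> e"
proof -
  obtain n v c where c: "cyc n v c" "bd F = range c" using face_cyc assms by blast
  obtain j where j: "e = c j" using assms c by auto
  then have "x = v j \<or> x = v (Suc j)" using assms(3) cyc_edge(2)[OF c(1)] by auto
  moreover have "v j = v (Suc (j + n - 1))"
    using cyc_period(1)[OF c(1), of j] cyc_ge_3[OF c(1)] by simp
  ultimately obtain i where i: "x = v (Suc i)" by metis
  then have eq: "{g \<in> bd F. x \<in> ends g} = {c i, c (Suc i)}"
    using cyc_edges_at[OF c(1)] c(2) by simp
  moreover have "c i \<noteq> c (Suc i)" using cyc_c_neq[OF c(1), of i "Suc i"] cyc_ge_3[OF c(1)] by simp
  moreover have "e \<in> {g \<in> bd F. x \<in> ends g}" using assms by simp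
  ultimately show ?thesis using that[of "c i"] that[of "c (Suc i)"] by auto
qed

lemma cyc_stays:
  assumes "cyc n v c" "F \<in> Fs" "bd F = range c" "c i \<in> K" "i \<le> j"
    and "\<And>x y. x \<in> K \<Longrightarrow> fadj x y \<Longrightarrow> y \<in> K \<or> y = f"
    and "\<And>m. i < m \<Longrightarrow> m \<le> j \<Longrightarrow> c m \<noteq> f"
  shows "c j \<in> K"
  using assms(5,7)
proof (induction j rule: dec_induct)
  case base
  then show ?case using assms(4) by simp
next
  case (step j)
  have "fadj (c j) (c (Suc j))"
    using fadj_cyc[OF assms(1-3), of j "Suc j"] cyc_ge_3[OF assms(1)] by simp
  moreover have "c j \<in> K" using step by simp
  ultimately show ?case using assms(6) step.prems[of "Suc j"] step.hyps by fastforce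
qed

text \<open>If \<open>K\<close> can be left only through \<open>f\<close>, then a face cycle through
  \<open>K\<close> that also reaches \<open>g\<close> outside would pass \<open>f\<close> both on
  the way to \<open>g\<close> and on the way back, but it contains \<open>f\<close> only
  once.\<close>

lemma face_confined:
  assumes "F \<in> Fs" "bd F \<inter> K \<noteq> {}"
    and K: "\<And>x y. x \<in> K \<Longrightarrow> fadj x y \<Longrightarrow> y \<in> K \<or> y = f"
  shows "bd F \<subseteq> insert f K"
proof
  fix g assume "g \<in> bd F"
  obtain n v c where c: "cyc n v c" "bd F = range c" using face_cyc assms by blast
  obtain i where i: "c i \<in> K" using assms c by auto
  obtain k where k: "g = c k" using \<open>g \<in> bd F\<close> c by auto
  obtain j where j: "i \<le> j" "j < i + n" "g = c j" using cyc_index[OF c(1), of i k] k by metis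
  show "g \<in> insert f K"
  proof (rule ccontr)
    assume g: "g \<notin> insert f K"
    obtain m where m: "i < m" "m \<le> j" "c m = f"
      using cyc_stays[OF c(1) assms(1) c(2) i j(1), of f] K g j(3) by blast
    \<comment> \<open>By symmetry of \<open>fadj\<close>, the complement too can be left only
      through \<open>f\<close>, which handles the way back.\<close>
    define L where "L = - insert f K"
    have L: "y \<in> L \<or> y = f" if "x \<in> L" "fadj x y" for x y
      using that K[of y x] fadj_sym[of x y] unfolding L_def by auto
    have "c (i + n) \<notin> L" using cyc_period(2)[OF c(1), of i] i by (simp add: L_def)
    then obtain m' where m': "j < m'" "m' \<le> i + n" "c m' = f"
      using cyc_stays[OF c(1) assms(1) c(2), of j L "i + n" f] L g j by (auto simp: L_def)
    then show False using cyc_c_neq[OF c(1), of m m'] m by simp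
  qed
qed

text \<open>If \<open>T\<close> were closed under \<open>fadj\<close>, every face meeting
  \<open>T\<close> would have all its edges in \<open>T\<close>. The set of these faces would be
  proper, nonempty and without boundary.\<close>

lemma fadj_connected:
  assumes "T \<subseteq> E" "T \<noteq> {}" "T \<noteq> E"
  shows "\<exists>x\<in>T. \<exists>y\<in>E - T. fadj x y"
proof (rule ccontr)
  assume no: "\<not> ?thesis"
  obtain f where f: "f \<in> E" "f \<notin> T" using assms by auto
  define S where "S = {F \<in> Fs. bd F \<inter> T \<noteq> {}}"
  have sub: "bd F \<subseteq> T" if F: "F \<in> S" for F
  proof -
    have T: "y \<in> T" if "x \<in> T" "fadj x y" for x y
      using no that bd_subset unfolding fadj_def by blast
    obtain n v c where c: "cyc n v c" "bd F = range c" using F face_cyc S_def by blast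
    obtain i where i: "c i \<in> T" using F c by (auto simp: S_def)
    \<comment> \<open>There is no exceptional edge here; an element of \<open>T\<close> itself plays
      that part.\<close>
    have "bd F \<subseteq> insert (c i) T"
      using F T by (intro face_confined) (auto simp: S_def)
    then show ?thesis using i by auto
  qed
  have "S \<subseteq> Fs" by (auto simp: S_def)
  moreover have "S \<noteq> {}"
  proof -
    obtain e where e: "e \<in> T" using assms by auto
    then have "card {F \<in> Fs. e \<in> bd F} = 2" using two_faces assms by auto
    then obtain F where "F \<in> Fs" "e \<in> bd F" by (auto simp: card_2_iff)
    then show ?thesis using e by (auto simp: S_def)
  qed
  moreover have "S \<noteq> Fs"
  proof -
    have "card {F \<in> Fs. f \<in> bd F} = 2" using two_faces f by auto
    then obtain F where "F \<in> Fs" "f \<in> bd F" by (auto simp: card_2_iff)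
    then show ?thesis using sub f by auto
  qed
  ultimately obtain e where e: "e \<in> boundary S" using boundary_nonempty by blast
  from boundary_faces[OF \<open>S \<subseteq> Fs\<close> e] obtain F F' where F: "F \<in> S" "F' \<in> Fs - S"
    "{F \<in> Fs. e \<in> bd F} = {F, F'}" by blast
  then have "e \<in> T" "e \<in> bd F'" using sub by auto
  then show False using F by (auto simp: S_def)
qed

lemma fadj_subset:
  assumes "e \<in> E" "ends e = {x, y}"
    and "F \<in> Fs" "F' \<in> Fs" "{F \<in> Fs. e \<in> bd F} = {F, F'}"
    and "{g \<in> bd F. x \<in> ends g} = {e, a}" "{g \<in> bd F'. x \<in> ends g} = {e, b}"
    and "{g \<in> bd F. y \<in> ends g} = {e, p}" "{g \<in> bd F'. y \<in> ends g} = {e, q}"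
  shows "{f. fadj e f} \<subseteq> {a, b, p, q}"
proof
  fix f assume "f \<in> {f. fadj e f}"
  then obtain G where f: "e \<noteq> f" "ends e \<inter> ends f \<noteq> {}" "G \<in> Fs" "e \<in> bd G" "f \<in> bd G"
    unfolding fadj_def by auto
  then have "G = F \<or> G = F'" "x \<in> ends f \<or> y \<in> ends f" using assms by auto
  then have "f \<in> {g \<in> bd F. x \<in> ends g} \<union> {g \<in> bd F'. x \<in> ends g} \<union>
      {g \<in> bd F. y \<in> ends g} \<union> {g \<in> bd F'. y \<in> ends g}" using f by auto
  then show "f \<in> {a, b, p, q}" unfolding assms using f(1) by auto
qed

text \<open>The candidates for neighbours of \<open>e\<close> are one edge per face at
  \<open>e\<close> and per end of \<open>e\<close>. Only those at \<open>x\<close> keep their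
  equations, as the parity argument takes place at one end.\<close>

lemma fadj_structure:
  assumes "e \<in> E" "F \<in> Fs" "e \<in> bd F"
  obtains x y F' a b p q where "ends e = {x, y}" "F' \<in> Fs"
    "{F \<in> Fs. e \<in> bd F} = {F, F'}" "F \<noteq> F'"
    "{g \<in> bd F. x \<in> ends g} = {e, a}" "{g \<in> bd F'. x \<in> ends g} = {e, b}"
    "{f. fadj e f} \<subseteq> {a, b, p, q}" "b \<noteq> e"
proof -
  obtain x y where xy: "ends e = {x, y}" using ends assms by blast
  obtain G H where GH: "{F \<in> Fs. e \<in> bd F} = {G, H}" "G \<noteq> H"
    using two_faces[OF assms(1)] by (auto simp: card_2_iff)
  have "F = G \<or> F = H" using GH assms by blast
  then obtain F' where F: "{F \<in> Fs. e \<in> bd F} = {F, F'}" "F \<noteq> F'"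
    using GH by (metis insert_commute)
  then have F': "F' \<in> Fs" "e \<in> bd F'" by auto
  have x: "x \<in> ends e" and y: "y \<in> ends e" using xy by auto
  obtain a where a: "{g \<in> bd F. x \<in> ends g} = {e, a}"
    using edges_at_face[OF assms(2,3) x] by metis
  obtain b where b: "{g \<in> bd F'. x \<in> ends g} = {e, b}" "b \<noteq> e"
    using edges_at_face[OF F' x] by metis
  obtain p where p: "{g \<in> bd F. y \<in> ends g} = {e, p}"
    using edges_at_face[OF assms(2,3) y] by metis
  obtain q where q: "{g \<in> bd F'. y \<in> ends g} = {e, q}"
    using edges_at_face[OF F' y] by metis
  show ?thesis
    using that[OF xy F'(1) F a b(1) fadj_subset[OF assms(1) xy assms(2) F'(1) F(1) a b(1) p q] b(2)] .
qed

lemma card_fadj_le: "e \<in> E \<Longrightarrow> card {f. fadj e f} \<le> 4"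
proof -
  assume e: "e \<in> E"
  then have "card {F \<in> Fs. e \<in> bd F} = 2" by (rule two_faces)
  then obtain F where "F \<in> Fs" "e \<in> bd F" by (auto simp: card_2_iff)
  from fadj_structure[OF e this] obtain a b p q where "{f. fadj e f} \<subseteq> {a, b, p, q}" .
  then have "card {f. fadj e f} \<le> card {a, b, p, q}" by (intro card_mono) auto
  also have "\<dots> \<le> 4" by (simp add: card_insert_if)
  finally show ?thesis .
qed

text \<open>
  If the neighbours of \<open>e\<close> outside a face cycle through \<open>e\<close> formed part of a set \<open>K\<close> attached
  only at \<open>e\<close>, the faces meeting \<open>K\<close> would have a boundary with exactly one edge at an end of \<open>e\<close>.
\<close>

lemma no_cut_edge:
  assumes e: "e \<in> E" and four: "4 \<le> card {f. fadj e f}"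
    and G: "G \<in> Fs" "e \<in> bd G" and K: "K \<subseteq> E - bd G"
    and K_closed: "\<And>x y. x \<in> K \<Longrightarrow> fadj x y \<Longrightarrow> y \<in> K \<or> y = e"
    and K_all: "\<And>y. fadj e y \<Longrightarrow> y \<in> K \<union> bd G"
  shows False
proof -
  from fadj_structure[OF e G] obtain x y G' a b p q where xy: "ends e = {x, y}"
    and G': "G' \<in> Fs" "{F \<in> Fs. e \<in> bd F} = {G, G'}" "G \<noteq> G'"
    and a: "{g \<in> bd G. x \<in> ends g} = {e, a}" and b: "{g \<in> bd G'. x \<in> ends g} = {e, b}"
    and sub: "{f. fadj e f} \<subseteq> {a, b, p, q}" and "b \<noteq> e" .
  \<comment> \<open>Otherwise \<open>e\<close> would have at most three neighbours.\<close>
  have "a \<noteq> b"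
  proof
    assume "a = b"
    then have "card {f. fadj e f} \<le> card {b, p, q}" using sub by (intro card_mono) auto
    also have "\<dots> \<le> 3" by (simp add: card_insert_if)
    finally show False using four by simp
  qed
  have bG': "b \<in> bd G'" "x \<in> ends b" "e \<in> bd G'" using G'(2) b by auto
  then have "fadj e b" using G'(1) xy \<open>b \<noteq> e\<close> unfolding fadj_def by auto
  moreover have "b \<notin> bd G" using a bG' \<open>a \<noteq> b\<close> \<open>b \<noteq> e\<close> by auto
  ultimately have "b \<in> K" using K_all by auto
  define S where "S = {F \<in> Fs. bd F \<inter> K \<noteq> {}}"
  have S: "S \<subseteq> Fs" "G' \<in> S" "G \<notin> S" using bG' G' \<open>b \<in> K\<close> K by (auto simp: S_def)
  have conf: "bd F \<subseteq> insert e K" if "F \<in> S" for F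
    using that K_closed by (intro face_confined) (auto simp: S_def)
  \<comment> \<open>A face meeting \<open>K\<close> has all its edges in \<open>K\<close> or equal
    to \<open>e\<close>, and a face not in \<open>S\<close> has none in \<open>K\<close>; they can
    share only \<open>e\<close>.\<close>
  have "f \<in> boundary S \<longleftrightarrow> f = e" if f: "f \<in> E" for f
  proof
    assume "f \<in> boundary S"
    from boundary_faces[OF S(1) this] obtain F F' where F: "F \<in> S" "F' \<in> Fs - S"
      "{F \<in> Fs. f \<in> bd F} = {F, F'}" by blast
    then have "f \<in> bd F" "f \<in> bd F'" by auto
    then show "f = e" using conf[OF F(1)] F(2) by (auto simp: S_def)
  next
    assume "f = e"
    moreover have "{F \<in> S. e \<in> bd F} = {G'}" using S G'(2) by auto
    ultimately show "f \<in> boundary S" using e by (simp add: boundary_def)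
  qed
  then have "{f \<in> boundary S. x \<in> ends f} = {e}"
    using xy e unfolding boundary_def by auto
  then show False using even_boundary_at[OF S(1), of x] by simp
qed

end

section \<open>Euler's formula as an inequality, edge counts and degrees\<close>

section \<open>Planar graphs are 5-degenerate\<close>

lemma rtranclp_distinct_path:
  assumes "r\<^sup>*\<^sup>* x y"
  obtains xs where "xs \<noteq> []" "distinct xs" "hd xs = x" "last xs = y" "successively r xs"
proof -
  have "\<exists>xs. xs \<noteq> [] \<and> distinct xs \<and> hd xs = x \<and> last xs = y \<and> successively r xs"
    using assms
  proof (induction rule: converse_rtranclp_induct)
    case base
    show ?case by (intro exI[of _ "[y]"]) simp
  next
    case (step x z)
    then obtain xs where xs: "xs \<noteq> []" "distinct xs" "hd xs = z" "last xs = y" "successively r xs"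
      by blast
    show ?case
    proof (cases "x \<in> set xs")
      case True
      then obtain ys zs where split: "xs = ys @ x # zs" by (meson split_list)
      then show ?thesis
        using xs by (intro exI[of _ "x # zs"]) (auto simp: successively_append_iff)
    next
      case False
      then show ?thesis
        using xs step.hyps by (intro exI[of _ "x # xs"]) (auto simp: successively_Cons)
    qed
  qed
  then show ?thesis using that by blast
qed

context plane_faces
begin

text \<open>A simple path in \<open>H\<close> is closed by \<open>h\<close>. A path with only two
  vertices would be an edge parallel to \<open>h\<close>.\<close>

lemma cycle_through:
  assumes H: "H \<subseteq> E" "h \<in> E - H" "ends h = {x, y}" "x \<noteq> y"
    and path: "(\<lambda>u w. \<exists>e\<in>H. ends e = {u, w})\<^sup>*\<^sup>* x y"
  obtains n v c where "cyc n v c" "h \<in> range c" "range c \<subseteq> insert h H"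
proof -
  from rtranclp_distinct_path[OF path]
  obtain xs where xs: "xs \<noteq> []" "distinct xs" "hd xs = x" "last xs = y"
    "successively (\<lambda>u w. \<exists>e\<in>H. ends e = {u, w}) xs" .
  define n where "n = length xs"
  have hd: "xs ! 0 = x" and last: "xs ! (n - 1) = y"
    using xs by (simp_all add: n_def hd_conv_nth last_conv_nth)
  have edge: "\<exists>e\<in>H. ends e = {xs ! i, xs ! Suc i}" if "Suc i < n" for i
    using xs(5) that unfolding successively_conv_nth n_def by auto
  have n3: "3 \<le> n"
  proof (rule ccontr)
    assume "\<not> 3 \<le> n"
    moreover have "n \<noteq> 0" using xs by (simp add: n_def)
    moreover have "n \<noteq> 1" using hd last H by auto
    ultimately have "n = 2" by simp
    then obtain e where "e \<in> H" "ends e = {x, y}" using edge[of 0] hd last by auto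
    then show False using H ends_eqD[of e h] by auto
  qed
  define pick where "pick i = (SOME e. e \<in> H \<and> ends e = {xs ! i, xs ! Suc i})" for i
  have pick: "pick i \<in> H \<and> ends (pick i) = {xs ! i, xs ! Suc i}" if "Suc i < n" for i
    unfolding pick_def by (rule someI_ex) (use edge[OF that] in blast)
  define v where "v i = xs ! (i mod n)" for i
  \<comment> \<open>The last index of each period carries \<open>h\<close>, which leads from
    \<open>y\<close> back to \<open>x\<close>.\<close>
  define c where "c i = (if Suc (i mod n) = n then h else pick (i mod n))" for i
  have range_c: "range c \<subseteq> insert h H"
  proof
    fix e assume "e \<in> range c"
    then obtain i where i: "e = c i" by auto
    have "i mod n < n" using n3 by simp
    then show "e \<in> insert h H" using pick[of "i mod n"] i by (auto simp: c_def)
  qed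
  have "c (n - 1) = h" using n3 by (simp add: c_def)
  then have h: "h \<in> range c" by auto
  have "ends (c i) = {v i, v (Suc i)}" for i
  proof (cases "Suc (i mod n) = n")
    case True
    then have "i mod n = n - 1" "Suc i mod n = 0" by (auto simp: mod_Suc)
    then show ?thesis using True H(3) hd last by (auto simp: c_def v_def insert_commute)
  next
    case False
    have "i mod n < n" using n3 by simp
    then have "Suc (i mod n) < n" using False by simp
    then show ?thesis using False pick[of "i mod n"] by (auto simp: c_def v_def mod_Suc)
  qed
  moreover have "v i \<noteq> v j" if "i < j" "j < i + n" for i j
  proof
    assume "v i = v j"
    moreover have "0 < length xs" using xs(1) by simp
    then have "i mod n < length xs" "j mod n < length xs"
      unfolding n_def by (rule mod_less_divisor)+
    ultimately have "i mod n = j mod n"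
      using nth_eq_iff_index_eq[OF xs(2)] by (simp add: v_def)
    then have "n dvd j - i" using mod_eq_dvd_iff_nat[of i j n] that by simp
    then show False using that dvd_imp_le[of n "j - i"] by auto
  qed
  moreover have "insert h H \<subseteq> E" using H(1,2) by auto
  then have "c i \<in> E" for i using range_c rangeI[of c i] by (meson subsetD)
  ultimately have "cyc n v c"
    unfolding cyc_def using n3 by (auto simp: v_def c_def)
  with h range_c show ?thesis using that by blast
qed

text \<open>
  Half of Euler's formula for the subgraph with edge set \<open>H\<close> on \<open>S\<close>: the values of \<open>\<phi>\<close>
  play the role of the faces of the subgraph and those of \<open>\<psi>\<close> that of its components.
\<close>

lemma euler_labelling:
  assumes "S \<subseteq> V" "H \<subseteq> {e \<in> E. ends e \<subseteq> S}" and nonempty: "Fs \<noteq> {}"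
  shows "\<exists>(\<phi> :: 'f \<Rightarrow> nat) (\<psi> :: 'v \<Rightarrow> 'v).
    card H + card (\<psi> ` S) + 1 \<le> card (\<phi> ` Fs) + card S \<and>
    (\<forall>g\<in>E - H. \<forall>F\<in>Fs. \<forall>F'\<in>Fs. g \<in> bd F \<and> g \<in> bd F' \<longrightarrow> \<phi> F = \<phi> F') \<and>
    (\<forall>x\<in>S. \<forall>y\<in>S. \<psi> x = \<psi> y \<longrightarrow> (\<lambda>u w. \<exists>e\<in>H. ends e = {u, w})\<^sup>*\<^sup>* x y)"
proof -
  have finS: "finite S" using finite_subset[OF assms(1) finite_V] .
  have "H \<subseteq> E" using assms(2) by auto
  then have "finite H" using finite_E by (rule finite_subset)
  then show ?thesis
    using assms(2)
  proof (induction H rule: finite_induct)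
    case empty
    have "(\<lambda>_. 0 :: nat) ` Fs = {0}" using nonempty by auto
    then show ?case
      by (intro exI[of _ "\<lambda>_. 0"] exI[of _ "\<lambda>x. x"]) simp
  next
    case (insert h H)
    let ?r = "\<lambda>H u w. \<exists>e\<in>H. ends e = {u, w}"
    obtain \<phi> :: "'f \<Rightarrow> nat" and \<psi> :: "'v \<Rightarrow> 'v" where
      count: "card H + card (\<psi> ` S) + 1 \<le> card (\<phi> ` Fs) + card S" and
      f: "\<forall>g\<in>E - H. \<forall>F\<in>Fs. \<forall>F'\<in>Fs. g \<in> bd F \<and> g \<in> bd F' \<longrightarrow> \<phi> F = \<phi> F'" and
      c: "\<forall>x\<in>S. \<forall>y\<in>S. \<psi> x = \<psi> y \<longrightarrow> (?r H)\<^sup>*\<^sup>* x y"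
      using insert.IH[OF order_trans[OF subset_insertI insert.prems]] by (elim exE conjE)
    have faces: "\<phi> F = \<phi> F'"
      if "g \<in> E - H" "F \<in> Fs" "F' \<in> Fs" "g \<in> bd F" "g \<in> bd F'" for g F F'
      using f that by blast
    have conn: "(?r H)\<^sup>*\<^sup>* x y" if "x \<in> S" "y \<in> S" "\<psi> x = \<psi> y" for x y
      using c that by blast
    have h: "h \<in> E" "ends h \<subseteq> S" and HE: "H \<subseteq> E" using insert.prems by auto
    obtain x y where xy: "x \<noteq> y" "ends h = {x, y}" using ends[OF h(1)] by blast
    then have xyS: "x \<in> S" "y \<in> S" using h by auto
    have mono: "(?r (insert h H))\<^sup>*\<^sup>* u w" if "(?r H)\<^sup>*\<^sup>* u w" for u w
      using that by (rule rtranclp_mono[THEN predicate2D, rotated]) auto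
    show ?case
    proof (cases "\<psi> x = \<psi> y")
      case False
      \<comment> \<open>\<open>h\<close> joins two components: their labels are merged, and one
        label disappears.\<close>
      define \<psi>' where "\<psi>' z = (if \<psi> z = \<psi> y then \<psi> x else \<psi> z)" for z
      have "\<psi>' ` S \<subseteq> \<psi> ` S - {\<psi> y}" using False xyS by (auto simp: \<psi>'_def)
      then have "card (\<psi>' ` S) \<le> card (\<psi> ` S - {\<psi> y})" using finS by (intro card_mono) auto
      also have "\<dots> < card (\<psi> ` S)" using finS xyS by (intro card_Diff1_less) auto
      finally have "card (insert h H) + card (\<psi>' ` S) + 1 \<le> card (\<phi> ` Fs) + card S"
        using count insert.hyps by simp
      moreover have "(?r (insert h H))\<^sup>*\<^sup>* u w" if uw: "u \<in> S" "w \<in> S" "\<psi>' u = \<psi>' w" for u w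
      proof -
        have "?r (insert h H) x y" "?r (insert h H) y x" using xy(2) by (auto simp: insert_commute)
        then have hop: "(?r (insert h H))\<^sup>*\<^sup>* x y" "(?r (insert h H))\<^sup>*\<^sup>* y x" by auto
        consider "\<psi> u = \<psi> w" | "\<psi> u = \<psi> x" "\<psi> w = \<psi> y" | "\<psi> u = \<psi> y" "\<psi> w = \<psi> x"
          using uw(3) by (auto simp: \<psi>'_def split: if_splits)
        then show ?thesis
        proof cases
          case 1
          then show ?thesis using conn uw mono by blast
        next
          case 2
          then have "(?r (insert h H))\<^sup>*\<^sup>* u x" "(?r (insert h H))\<^sup>*\<^sup>* y w"
            using conn[of u x] conn[of y w] uw xyS mono by auto
          then show ?thesis using hop by (meson rtranclp_trans)
        next
          case 3
          then have "(?r (insert h H))\<^sup>*\<^sup>* u y" "(?r (insert h H))\<^sup>*\<^sup>* x w"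
            using conn[of u y] conn[of x w] uw xyS mono by auto
          then show ?thesis using hop by (meson rtranclp_trans)
        qed
      qed
      ultimately show ?thesis
        using f by (intro exI[of _ \<phi>] exI[of _ \<psi>'] conjI ballI impI) blast+
    next
      case True
      \<comment> \<open>\<open>h\<close> closes a cycle, which bounds a set \<open>T\<close>
        containing exactly one of the two faces at \<open>h\<close>. Their common class is split
        along \<open>T\<close>: the part inside gets a fresh label. Edges outside the new subgraph
        are not on the cycle, so their faces still agree.\<close>
      have "h \<in> E - H" using h insert.hyps by simp
      from cycle_through[OF HE this xy(2,1) conn[OF xyS True]]
      obtain n v c where c: "cyc n v c" "h \<in> range c" "range c \<subseteq> insert h H" .
      obtain T where T: "T \<subseteq> Fs" "boundary T = range c" using cyc_boundary[OF c(1)] by blast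
      obtain F F' where F: "F \<in> T" "F' \<in> Fs - T" "{F \<in> Fs. h \<in> bd F} = {F, F'}"
        using boundary_faces[OF T(1), of h] T c by auto
      then have hF: "h \<in> bd F" "h \<in> bd F'" and FFs: "F \<in> Fs" "F' \<in> Fs" using T(1) by auto
      have same: "\<phi> F = \<phi> F'" using faces[of h F F'] h insert.hyps hF FFs by auto
      define k where "k = Suc (Max (\<phi> ` Fs))"
      have k: "\<phi> G < k" if "G \<in> Fs" for G
        using that finite_Fs by (simp add: k_def less_Suc_eq_le)
      define \<phi>' where "\<phi>' G = (if G \<in> T \<and> \<phi> G = \<phi> F then k else \<phi> G)" for G
      have "insert k (\<phi> ` Fs) \<subseteq> \<phi>' ` Fs"
      proof
        fix a assume "a \<in> insert k (\<phi> ` Fs)"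
        then consider "a = k" | G where "G \<in> Fs" "a = \<phi> G" by auto
        then show "a \<in> \<phi>' ` Fs"
        proof cases
          case 1
          then have "a = \<phi>' F" using F by (simp add: \<phi>'_def)
          then show ?thesis using FFs by auto
        next
          case 2
          show ?thesis
          proof (cases "\<phi> G = \<phi> F")
            case True
            then have "a = \<phi>' F'" using F 2 same by (simp add: \<phi>'_def)
            then show ?thesis using FFs by auto
          next
            case False
            then have "a = \<phi>' G" using 2 by (simp add: \<phi>'_def)
            then show ?thesis using 2 by auto
          qed
        qed
      qed
      then have "card (insert k (\<phi> ` Fs)) \<le> card (\<phi>' ` Fs)" using finite_Fs by (intro card_mono) auto
      moreover have "k \<notin> \<phi> ` Fs" using k by auto
      ultimately have "card (\<phi> ` Fs) + 1 \<le> card (\<phi>' ` Fs)" using finite_Fs by simp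
      then have "card (insert h H) + card (\<psi> ` S) + 1 \<le> card (\<phi>' ` Fs) + card S"
        using count insert.hyps by simp
      moreover have "\<phi>' G = \<phi>' G'"
        if g: "g \<in> E - insert h H" "G \<in> Fs" "G' \<in> Fs" "g \<in> bd G" "g \<in> bd G'" for g G G'
      proof -
        have "\<phi> G = \<phi> G'" using faces[of g G G'] g by auto
        moreover have "g \<notin> boundary T" using g T c(3) by auto
        then have "G \<in> T \<longleftrightarrow> G' \<in> T" using not_boundary_same[OF T(1), of g G G'] g by auto
        ultimately show ?thesis by (simp add: \<phi>'_def)
      qed
      moreover have "(?r (insert h H))\<^sup>*\<^sup>* u w" if "u \<in> S" "w \<in> S" "\<psi> u = \<psi> w" for u w
        using conn[OF that] mono by blast
      ultimately show ?thesis by (intro exI[of _ \<phi>'] exI[of _ \<psi>] conjI ballI impI) blast+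
    qed
  qed
qed

text \<open>Every face class has at least three boundary edges, all inside \<open>S\<close>, and an
  edge bounds at most two classes. With \<open>euler_labelling\<close> this is the usual count
  leading to at most \<open>3 * card S - 6\<close> edges when there are two classes or more.\<close>

lemma sparse:
  assumes "S \<subseteq> V" "S \<noteq> {}"
  shows "card {e \<in> E. ends e \<subseteq> S} < 3 * card S"
proof (cases "Fs = {}")
  case True
  then have "E = {}" using two_faces by fastforce
  moreover have "finite S" using assms finite_V finite_subset by auto
  ultimately show ?thesis using assms by (simp add: card_gt_0_iff)
next
  case False
  let ?H = "{e \<in> E. ends e \<subseteq> S}"
  have fin: "finite S" "finite ?H" using assms finite_V finite_E finite_subset by auto
  have "card S > 0" using fin assms by (simp add: card_gt_0_iff)
  obtain \<phi> :: "'f \<Rightarrow> nat" and \<psi> :: "'v \<Rightarrow> 'v" where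
    count: "card ?H + card (\<psi> ` S) + 1 \<le> card (\<phi> ` Fs) + card S" and
    f: "\<forall>g\<in>E - ?H. \<forall>F\<in>Fs. \<forall>F'\<in>Fs. g \<in> bd F \<and> g \<in> bd F' \<longrightarrow> \<phi> F = \<phi> F'"
    using euler_labelling[OF assms(1) order_refl False] by (elim exE conjE)
  have faces: "\<phi> F = \<phi> F'"
    if "g \<in> E - ?H" "F \<in> Fs" "F' \<in> Fs" "g \<in> bd F" "g \<in> bd F'" for g F F'
    using f that by blast
  have "card (\<psi> ` S) > 0" using fin assms by (simp add: card_gt_0_iff)
  show ?thesis
  \<comment> \<open>The set of all faces has empty boundary, so the count needs two classes; with
    one class the Euler inequality alone suffices.\<close>
  proof (cases "card (\<phi> ` Fs) \<le> 1")
    case True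
    then show ?thesis using count \<open>card S > 0\<close> by simp
  next
    case False
    let ?S = "\<lambda>a. {F \<in> Fs. \<phi> F = a}"
    have sub: "boundary (?S a) \<subseteq> ?H" for a
    proof
      fix e assume e: "e \<in> boundary (?S a)"
      have S: "?S a \<subseteq> Fs" by auto
      obtain F F' where F: "F \<in> ?S a" "F' \<in> Fs - ?S a" "{F \<in> Fs. e \<in> bd F} = {F, F'}"
        using boundary_faces[OF S e] by blast
      then have "e \<in> bd F" "e \<in> bd F'" by auto
      moreover have "\<phi> F \<noteq> \<phi> F'" "F \<in> Fs" "F' \<in> Fs" using F(1,2) by auto
      ultimately have "e \<notin> E - ?H" using faces by metis
      moreover have "e \<in> E" using e by (simp add: boundary_def)
      ultimately show "e \<in> ?H" by blast
    qed
    have three: "3 \<le> card (boundary (?S a))" if a: "a \<in> \<phi> ` Fs" for a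
    proof (intro card_boundary_ge_3 boundary_nonempty)
      show "?S a \<noteq> Fs"
      proof
        assume "?S a = Fs"
        then have "\<phi> ` Fs \<subseteq> {a}" by auto
        then have "card (\<phi> ` Fs) \<le> card {a}" by (intro card_mono) auto
        then show False using False by simp
      qed
    qed (use a in auto)
    have "3 * card (\<phi> ` Fs) = (\<Sum>a\<in>\<phi> ` Fs. 3)" by simp
    also have "\<dots> \<le> (\<Sum>a\<in>\<phi> ` Fs. card (boundary (?S a)))" using three by (rule sum_mono)
    also have "\<dots> = (\<Sum>a\<in>\<phi> ` Fs. \<Sum>e\<in>?H. if e \<in> boundary (?S a) then 1 else 0)"
    proof (rule sum.cong)
      fix a
      have "boundary (?S a) = {e \<in> ?H. e \<in> boundary (?S a)}" using sub[of a] by blast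
      then show "card (boundary (?S a)) = (\<Sum>e\<in>?H. if e \<in> boundary (?S a) then 1 else 0)"
        using fin(2) by (simp only: sum.inter_filter[symmetric] card_eq_sum)
    qed simp
    also have "\<dots> = (\<Sum>e\<in>?H. \<Sum>a\<in>\<phi> ` Fs. if e \<in> boundary (?S a) then 1 else 0)"
      by (rule sum.swap)
    also have "\<dots> \<le> (\<Sum>e\<in>?H. 2)"
    proof (rule sum_mono)
      fix e assume e: "e \<in> ?H"
      let ?A = "{a \<in> \<phi> ` Fs. e \<in> boundary (?S a)}"
      \<comment> \<open>Only the classes of the two faces at \<open>e\<close> can have
        \<open>e\<close> on their boundary.\<close>
      have "?A \<subseteq> \<phi> ` {F \<in> Fs. e \<in> bd F}"
      proof
        fix a assume "a \<in> ?A"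
        then have "card {F \<in> ?S a. e \<in> bd F} = 1" by (simp add: boundary_def)
        then obtain F where "F \<in> ?S a" "e \<in> bd F"
          by (metis (no_types, lifting) card.empty empty_Collect_eq mem_Collect_eq zero_neq_one)
        then show "a \<in> \<phi> ` {F \<in> Fs. e \<in> bd F}" by auto
      qed
      then have "card ?A \<le> card (\<phi> ` {F \<in> Fs. e \<in> bd F})"
        using finite_Fs by (intro card_mono) auto
      also have "\<dots> \<le> card {F \<in> Fs. e \<in> bd F}" using finite_Fs by (intro card_image_le) auto
      also have "\<dots> = 2" using two_faces e by auto
      finally show "(\<Sum>a\<in>\<phi> ` Fs. if e \<in> boundary (?S a) then 1 else 0) \<le> (2 :: nat)"
        using finite_Fs by (simp add: sum.inter_filter[symmetric])
    qed
    also have "\<dots> = 2 * card ?H" by simp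
    finally have "3 * card (\<phi> ` Fs) \<le> 2 * card ?H" .
    then show ?thesis using count \<open>card S > 0\<close> \<open>card (\<psi> ` S) > 0\<close> by linarith
  qed
qed

text \<open>Minimum degree 6 on \<open>S\<close> would give at least \<open>3 * card S\<close> edges
  by the handshake count.\<close>

lemma degenerate:
  assumes "S \<subseteq> V" "S \<noteq> {}"
  shows "\<exists>x\<in>S. card {y. \<exists>e\<in>E. ends e = {x, y} \<and> y \<in> S} \<le> 5"
proof (rule ccontr)
  assume no: "\<not> ?thesis"
  let ?H = "{e \<in> E. ends e \<subseteq> S}"
  have fin: "finite S" "finite ?H" using assms finite_V finite_E finite_subset by auto
  have "6 \<le> card {e \<in> ?H. x \<in> ends e}" if x: "x \<in> S" for x
  proof -
    let ?N = "{y. \<exists>e\<in>E. ends e = {x, y} \<and> y \<in> S}"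
    define f where "f y = (SOME e. e \<in> E \<and> ends e = {x, y})" for y
    have f: "f y \<in> E \<and> ends (f y) = {x, y}" if "y \<in> ?N" for y
      unfolding f_def by (rule someI_ex) (use that in blast)
    have "inj_on f ?N"
    proof (rule inj_onI)
      fix y z assume yz: "y \<in> ?N" "z \<in> ?N" "f y = f z"
      have "ends (f y) = {x, y}" "ends (f z) = {x, z}" using f[OF yz(1)] f[OF yz(2)] by simp_all
      then have "{x, y} = {x, z}" using yz(3) by simp
      then show "y = z" by (auto simp: doubleton_eq_iff)
    qed
    moreover have "f ` ?N \<subseteq> {e \<in> ?H. x \<in> ends e}"
    proof
      fix e assume "e \<in> f ` ?N"
      then obtain y where y: "y \<in> ?N" "e = f y" by blast
      then show "e \<in> {e \<in> ?H. x \<in> ends e}" using f[OF y(1)] x by auto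
    qed
    ultimately have "card ?N \<le> card {e \<in> ?H. x \<in> ends e}"
      using finite_E by (intro card_inj_on_le) auto
    moreover have "\<not> card ?N \<le> 5" using no x by auto
    ultimately show ?thesis by simp
  qed
  then have "(\<Sum>x\<in>S. 6 :: nat) \<le> (\<Sum>x\<in>S. card {e \<in> ?H. x \<in> ends e})" by (rule sum_mono)
  also have "\<dots> = (\<Sum>x\<in>S. \<Sum>e\<in>?H. if x \<in> ends e then 1 else 0)"
    using fin by (simp add: sum.inter_filter[symmetric])
  also have "\<dots> = (\<Sum>e\<in>?H. \<Sum>x\<in>S. if x \<in> ends e then 1 else 0)" by (rule sum.swap)
  also have "\<dots> = (\<Sum>e\<in>?H. 2)"
  proof (rule sum.cong)
    fix e assume "e \<in> ?H"
    then have "{x \<in> S. x \<in> ends e} = ends e" "card (ends e) = 2" using card_ends by auto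
    then show "(\<Sum>x\<in>S. if x \<in> ends e then 1 else 0) = (2::nat)"
      using fin by (simp add: sum.inter_filter[symmetric])
  qed simp
  also have "\<dots> = 2 * card ?H" by simp
  finally have "3 * card S \<le> card ?H" by simp
  with sparse[OF assms] show False by simp
qed

end

section \<open>Arcs, sides of cycles and winding numbers\<close>

section \<open>Cycles of a plane graph as Jordan curves\<close>

text \<open>The inverse of the arc would map a nonempty open set of the plane continuously and
  injectively into the line.\<close>

lemma interior_arc_image:
  fixes g :: "real \<Rightarrow> complex"
  assumes "arc g"
  shows "interior (path_image g) = {}"
proof (rule ccontr)
  assume ne: "interior (path_image g) \<noteq> {}"
  obtain h where h: "homeomorphism {0..1} (path_image g) g h"
    using homeomorphism_arc[OF assms] by blast
  have "continuous_on (interior (path_image g)) h"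
    using h interior_subset unfolding homeomorphism_def by (metis continuous_on_subset)
  moreover have "inj_on h (interior (path_image g))"
    using h interior_subset unfolding homeomorphism_def by (metis inj_on_inverseI inj_on_subset)
  ultimately have "DIM(complex) \<le> DIM(real)"
    using invariance_of_dimension[of "interior (path_image g)" h] ne by auto
  then show False by simp
qed

locale simple_plane =
  fixes V :: "complex set" and E :: "complex set set"
  assumes simple_plane_graph: "simple_plane_graph V E"
begin

lemma edge_arc:
  assumes "e \<in> E"
  obtains g where "arc g" "path_image g = e" "ends V e = {pathstart g, pathfinish g}"
proof -
  have "\<forall>e\<in>E. \<exists>g. arc g \<and> path_image g = e \<and> ends V e = {pathstart g, pathfinish g}"
    using simple_plane_graph by (simp add: simple_plane_graph_def)
  then show ?thesis using assms that by blast
qed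

lemma edges_meet: "e \<in> E \<Longrightarrow> f \<in> E \<Longrightarrow> e \<noteq> f \<Longrightarrow> e \<inter> f \<subseteq> V"
  using simple_plane_graph by (simp add: simple_plane_graph_def)

sublocale simple_graph V E "ends V"
proof
  show "finite V" "finite E" "inj_on (ends V) E"
    using simple_plane_graph unfolding simple_plane_graph_def by auto
  fix e assume "e \<in> E"
  then obtain g where g: "arc g" "path_image g = e" "ends V e = {pathstart g, pathfinish g}"
    using edge_arc by blast
  moreover have "ends V e \<subseteq> V" by (auto simp: ends_def)
  ultimately show "\<exists>u v. u \<noteq> v \<and> u \<in> V \<and> v \<in> V \<and> ends V e = {u, v}"
    using arc_distinct_ends[OF g(1)] by (intro exI[of _ "pathstart g"] exI[of _ "pathfinish g"]) auto
qed

lemma edge_arc_from: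
  assumes "e \<in> E" "ends V e = {a, b}"
  obtains g where "arc g" "path_image g = e" "pathstart g = a" "pathfinish g = b"
proof -
  obtain g where g: "arc g" "path_image g = e" "ends V e = {pathstart g, pathfinish g}"
    using edge_arc[OF assms(1)] by blast
  then consider "pathstart g = a" "pathfinish g = b" | "pathstart g = b" "pathfinish g = a"
    using assms(2) by (auto simp: doubleton_eq_iff)
  then show ?thesis
  proof cases
    case 1
    then show ?thesis using g that by blast
  next
    case 2
    then show ?thesis using g that[of "reversepath g"] by (simp add: arc_reversepath)
  qed
qed

lemma edge_closed: "e \<in> E \<Longrightarrow> closed e"
  by (metis edge_arc closed_arc_image)

lemma edge_minus_V_nonempty: "e \<in> E \<Longrightarrow> e - V \<noteq> {}"
proof
  assume e: "e \<in> E" "e - V = {}"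
  then obtain g where g: "arc g" "path_image g = e" using edge_arc by blast
  have "finite e" using e finite_V finite_subset by auto
  moreover have "infinite (g ` {0..1})"
    using g(1) by (simp add: arc_def finite_image_iff)
  ultimately show False using g(2) by (simp add: path_image_def)
qed

definition skeleton :: "complex set" where
  "skeleton = V \<union> \<Union>E"

lemma near_edge:
  assumes "e \<in> E" "p \<in> e - V"
  obtains r where "r > 0" "ball p r \<inter> skeleton \<subseteq> e"
proof -
  let ?C = "V \<union> \<Union>(E - {e})"
  have "closed ?C"
    using finite_V finite_E edge_closed by (intro closed_Un closed_Union finite_imp_closed) auto
  then have "open (- ?C)" by (rule open_Compl)
  moreover have "p \<in> - ?C"
    using assms edges_meet by auto
  ultimately obtain r where "r > 0" "ball p r \<subseteq> - ?C" by (rule openE)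
  then show ?thesis using that[of r] by (auto simp: skeleton_def)
qed

text \<open>Near \<open>p\<close> the skeleton consists of \<open>e\<close> alone, which has empty
  interior and so fills no ball.\<close>

lemma edge_in_closure_compl:
  assumes "e \<in> E" "p \<in> e - V"
  shows "p \<in> closure (- skeleton)"
proof -
  have "ball p r \<inter> - skeleton \<noteq> {}" if "r > 0" for r
  proof
    assume "ball p r \<inter> - skeleton = {}"
    obtain r' where r': "r' > 0" "ball p r' \<inter> skeleton \<subseteq> e" using near_edge[OF assms] .
    then have "ball p (min r r') \<subseteq> e" using \<open>ball p r \<inter> - skeleton = {}\<close> by fastforce
    then have "p \<in> interior e" using r'(1) \<open>r > 0\<close> unfolding mem_interior by (meson min_less_iff_conj)
    moreover obtain g where "arc g" "path_image g = e" using edge_arc[OF assms(1)] by blast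
    ultimately show False using interior_arc_image by auto
  qed
  then have "\<exists>y\<in>- skeleton. dist y p < r" if "r > 0" for r
    using that by (metis Int_iff disjoint_iff dist_commute mem_ball)
  then show ?thesis by (simp add: closure_approachable)
qed

lemma skeleton_closed: "closed skeleton"
  unfolding skeleton_def
  using finite_V finite_E edge_closed by (intro closed_Un closed_Union finite_imp_closed) auto

lemma faces_eq: "faces V E = components (- skeleton)"
  by (simp only: faces_def skeleton_def)

lemma face_props:
  assumes "F \<in> faces V E"
  shows "open F" "connected F" "F \<noteq> {}" "F \<inter> skeleton = {}"
proof -
  have F: "F \<in> components (- skeleton)" using assms by (simp only: faces_eq)
  show "open F" using open_components[OF open_Compl[OF skeleton_closed] F] .
  show "connected F" using in_components_connected[OF F] .
  show "F \<noteq> {}" using in_components_nonempty[OF F] .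
  show "F \<inter> skeleton = {}" using in_components_subset[OF F] by blast
qed

lemma faces_disjoint: "F \<in> faces V E \<Longrightarrow> G \<in> faces V E \<Longrightarrow> F \<noteq> G \<Longrightarrow> F \<inter> G = {}"
  unfolding faces_eq by (simp add: components_nonoverlap)

lemma Union_faces: "\<Union>(faces V E) = - skeleton"
  unfolding faces_eq by (rule Union_components)

lemma in_edge_of_cycle:
  assumes "cyc n v c" "e \<in> E" "p \<in> e - V" "p \<in> \<Union>(range c)"
  shows "e \<in> range c"
proof -
  obtain i where "p \<in> c i" using assms(4) by blast
  then have "e = c i"
    using edges_meet[OF assms(2) cyc_edge(1)[OF assms(1), of i]] assms(3) by blast
  then show ?thesis by simp
qed

text \<open>At least one edge of the cycle is left out, so the two end vertices differ and the
  joined path is an arc.\<close>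

lemma cyc_segment:
  assumes c: "cyc n v c" and "m + 1 < n"
  obtains P where "arc P" "pathstart P = v p" "pathfinish P = v (p + Suc m)"
    "path_image P = \<Union>(c ` {p..p + m})"
proof -
  have "\<exists>P. arc P \<and> pathstart P = v p \<and> pathfinish P = v (p + Suc m) \<and>
    path_image P = \<Union>(c ` {p..p + m})"
    using assms(2)
  proof (induction m)
    case 0
    obtain g where "arc g" "path_image g = c p" "pathstart g = v p" "pathfinish g = v (Suc p)"
      using edge_arc_from[OF cyc_edge(1)[OF c, of p] cyc_edge(2)[OF c, of p]] .
    then show ?case by (intro exI[of _ g]) simp
  next
    case (Suc m)
    then have "m + 1 < n" by simp
    from Suc.IH[OF this] obtain P where P: "arc P" "pathstart P = v p"
      "pathfinish P = v (p + Suc m)" "path_image P = \<Union>(c ` {p..p + m})" by blast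
    obtain g where g: "arc g" "path_image g = c (p + Suc m)" "pathstart g = v (p + Suc m)"
      "pathfinish g = v (Suc (p + Suc m))"
      using edge_arc_from[OF cyc_edge(1)[OF c, of "p + Suc m"] cyc_edge(2)[OF c, of "p + Suc m"]] .
    have "path_image P \<inter> path_image g \<subseteq> {pathstart g}"
    proof
      fix x assume "x \<in> path_image P \<inter> path_image g"
      then obtain i where i: "p \<le> i" "i \<le> p + m" "x \<in> c i" "x \<in> c (p + Suc m)"
        using P(4) g(2) by auto
      have "c i \<noteq> c (p + Suc m)" using cyc_c_neq[OF c, of i "p + Suc m"] i Suc.prems by simp
      then have "x \<in> V"
        using edges_meet[OF cyc_edge(1)[OF c, of i] cyc_edge(1)[OF c, of "p + Suc m"]] i by auto
      then have "x \<in> ends V (c i)" "x \<in> ends V (c (p + Suc m))" using i by (auto simp: ends_def)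
      then have "x = v i \<or> x = v (Suc i)" "x = v (p + Suc m) \<or> x = v (Suc (p + Suc m))"
        using cyc_edge(2)[OF c] by auto
      moreover have "v i \<noteq> v (Suc (p + Suc m))" "v (Suc i) \<noteq> v (Suc (p + Suc m))"
        using i Suc.prems cyc_v_neq[OF c, of i "Suc (p + Suc m)"]
          cyc_v_neq[OF c, of "Suc i" "Suc (p + Suc m)"] by auto
      ultimately show "x \<in> {pathstart g}" using g(3) by auto
    qed
    then have "arc (P +++ g)" using P g by (intro arc_join) auto
    moreover have "path_image (P +++ g) = \<Union>(c ` {p..p + Suc m})"
      using P g by (simp add: path_image_join atLeastAtMostSuc_conv Un_commute)
    ultimately show ?case using P g by (intro exI[of _ "P +++ g"]) simp
  qed
  then show ?thesis using that by blast
qed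

text \<open>The parametrisation \<open>g\<close> of \<open>e\<close> is prescribed, so that
  different cycles through \<open>e\<close> can be traversed with the same first piece.\<close>

lemma cyc_loop:
  assumes c: "cyc n v c" and e: "e \<in> range c"
    and g: "arc g" "path_image g = e" "ends V e = {pathstart g, pathfinish g}"
  obtains P where "arc P" "pathstart P = pathfinish g" "pathfinish P = pathstart g"
    "path_image P = \<Union>(range c - {e})" "simple_path (g +++ P)"
    "path_image (g +++ P) = \<Union>(range c)"
proof -
  obtain p where p: "e = c p" using e by auto
  have n: "3 \<le> n" by (rule cyc_ge_3[OF c])
  then have "n - 2 + 1 < n" by simp
  from cyc_segment[OF c this] obtain Q where Q: "arc Q" "pathstart Q = v (Suc p)"
    "pathfinish Q = v (Suc p + Suc (n - 2))" "path_image Q = \<Union>(c ` {Suc p..Suc p + (n - 2)})" .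
  have "Suc p + Suc (n - 2) = p + n" using n by simp
  with Q(3) cyc_period(1)[OF c, of p] have Qf: "pathfinish Q = v p" by (simp only:)
  have "c ` {Suc p..Suc p + (n - 2)} = range c - {e}"
  proof (intro equalityI subsetI)
    fix f assume "f \<in> c ` {Suc p..Suc p + (n - 2)}"
    then obtain j where "f = c j" "p < j" "j < p + n" using n by auto
    then show "f \<in> range c - {e}" using cyc_c_neq[OF c, of p j] p by auto
  next
    fix f assume "f \<in> range c - {e}"
    then obtain i where i: "f = c i" "f \<noteq> c p" using p by auto
    obtain j where j: "p \<le> j" "j < p + n" "c i = c j" using cyc_index[OF c, of p i] by metis
    then have "j \<noteq> p" using i by auto
    then have "j \<in> {Suc p..Suc p + (n - 2)}" using j n by auto
    then show "f \<in> c ` {Suc p..Suc p + (n - 2)}" using i j by auto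
  qed
  then have Qi: "path_image Q = \<Union>(range c - {e})" using Q(4) by simp
  have ep: "ends V e = {v p, v (Suc p)}" using cyc_edge(2)[OF c] p by simp
  then have "{pathstart g, pathfinish g} = {v p, v (Suc p)}" using g(3) by simp
  then consider "pathstart g = v p" "pathfinish g = v (Suc p)"
    | "pathstart g = v (Suc p)" "pathfinish g = v p"
    by (auto simp: doubleton_eq_iff)
  then obtain P where P: "arc P" "pathstart P = pathfinish g" "pathfinish P = pathstart g"
    "path_image P = \<Union>(range c - {e})"
  proof cases
    case 1
    then show ?thesis using that[of Q] Q Qf Qi by simp
  next
    case 2
    then show ?thesis using that[of "reversepath Q"] Q Qf Qi by (simp add: arc_reversepath)
  qed
  have eE: "e \<in> E" using cyc_edge(1)[OF c] p by simp
  have "path_image g \<inter> path_image P \<subseteq> V"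
    unfolding g(2) P(4) using edges_meet[OF eE] cyc_edge(1)[OF c] by fastforce
  then have "path_image g \<inter> path_image P \<subseteq> ends V e" using g(2) by (auto simp: ends_def)
  then have "simple_path (g +++ P)"
    using g P by (intro simple_path_join_loop) auto
  moreover have "path_image (g +++ P) = \<Union>(range c)"
    using g(2) P e by (auto simp: path_image_join)
  ultimately show ?thesis using that P by blast
qed

lemma cyc_jordan:
  assumes c: "cyc n v c" and J: "J = \<Union>(range c)"
  shows "open (inside J)" "connected (inside J)" "frontier (inside J) = J"
    "open (outside J)" "connected (outside J)" "frontier (outside J) = J"
proof -
  obtain g where g: "arc g" "path_image g = c 0" "ends V (c 0) = {pathstart g, pathfinish g}"
    using edge_arc[OF cyc_edge(1)[OF c]] .
  from cyc_loop[OF c rangeI g] obtain P where P: "arc P" "pathstart P = pathfinish g"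
    "pathfinish P = pathstart g" "path_image P = \<Union>(range c - {c 0})" "simple_path (g +++ P)"
    "path_image (g +++ P) = \<Union>(range c)" .
  then show "open (inside J)" "connected (inside J)" "frontier (inside J) = J"
    "open (outside J)" "connected (outside J)" "frontier (outside J) = J"
    using Jordan_inside_outside[of "g +++ P"] J by auto
qed

lemma cyc_subset_skeleton: "cyc n v c \<Longrightarrow> \<Union>(range c) \<subseteq> skeleton"
  using cyc_edge(1) by (fastforce simp: skeleton_def)

lemma face_subset_side:
  assumes c: "cyc n v c" and F: "F \<in> faces V E"
    and U: "U = inside (\<Union>(range c)) \<or> U = outside (\<Union>(range c))" "F \<inter> U \<noteq> {}"
  shows "F \<subseteq> U"
proof -
  have "frontier U = \<Union>(range c)" using U(1) cyc_jordan(3,6)[OF c refl] by metis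
  then have "F \<inter> frontier U = {}"
    using cyc_subset_skeleton[OF c] face_props(4)[OF F] by blast
  then show ?thesis
    using connected_Int_frontier[OF face_props(2)[OF F] U(2)] by auto
qed

text \<open>\<open>F\<close> lies in one side of its frontier cycle, as it is connected and misses
  the cycle. That side is connected and misses the frontier of \<open>F\<close>, so it lies in
  \<open>F\<close>.\<close>

lemma face_side:
  assumes c: "cyc n v c" and F: "F \<in> faces V E" "frontier F = \<Union>(range c)"
  shows "F = inside (\<Union>(range c)) \<or> F = outside (\<Union>(range c))"
proof -
  let ?J = "\<Union>(range c)"
  have "F \<inter> ?J = {}" using cyc_subset_skeleton[OF c] face_props(4)[OF F(1)] by blast
  then have "F \<subseteq> inside ?J \<union> outside ?J" using inside_Un_outside[of ?J] by blast
  then have "F \<inter> inside ?J \<noteq> {} \<or> F \<inter> outside ?J \<noteq> {}"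
    using face_props(3)[OF F(1)] by blast
  then obtain U where U: "U = inside ?J \<or> U = outside ?J" "F \<inter> U \<noteq> {}" by metis
  then have "F \<subseteq> U" by (intro face_subset_side[OF c F(1)])
  moreover have "U \<subseteq> F"
  proof -
    have "connected U" using U(1) cyc_jordan(2,5)[OF c refl] by metis
    moreover have "U \<inter> frontier F = {}"
      using U(1) unfolding F(2) by (metis inside_no_overlap outside_no_overlap)
    ultimately show ?thesis using connected_Int_frontier[of U F] U(2) by blast
  qed
  ultimately show ?thesis using U(1) by auto
qed

text \<open>The winding number is 0 outside and constantly 1 or -1 inside. The statement treats both
  sides alike, because \<open>F\<close> may be the unbounded face.\<close>

lemma winding_number_face:
  assumes \<gamma>: "simple_path \<gamma>" "pathfinish \<gamma> = pathstart \<gamma>"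
    and F: "F = inside (path_image \<gamma>) \<or> F = outside (path_image \<gamma>)"
  obtains a b where "a \<noteq> b" "\<forall>z\<in>F. winding_number \<gamma> z = a"
    "\<forall>z. z \<notin> F \<and> z \<notin> path_image \<gamma> \<longrightarrow> winding_number \<gamma> z = b"
proof -
  obtain a :: complex where a: "a \<noteq> 0" "\<And>z. z \<in> inside (path_image \<gamma>) \<Longrightarrow> winding_number \<gamma> z = a"
    using simple_closed_path_winding_number_inside[OF \<gamma>(1)] by (metis one_neq_zero neg_equal_0_iff_equal)
  have out: "winding_number \<gamma> z = 0" if "z \<in> outside (path_image \<gamma>)" for z
    using winding_number_zero_in_outside[OF simple_path_imp_path[OF \<gamma>(1)] \<gamma>(2) that] .
  have comp: "z \<in> inside (path_image \<gamma>) \<or> z \<in> outside (path_image \<gamma>)" if "z \<notin> path_image \<gamma>" for z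
    using that inside_Un_outside[of "path_image \<gamma>"] by blast
  show ?thesis
    using F
  proof
    assume "F = inside (path_image \<gamma>)"
    then show ?thesis using that[of a 0] a out comp by blast
  next
    assume "F = outside (path_image \<gamma>)"
    then show ?thesis using that[of 0 a] a out comp by metis
  qed
qed

end

section \<open>Incidence of edges and faces, and boundaries of sets of faces\<close>

section \<open>The faces of a plane graph bounded by cycles\<close>

context simple_graph
begin

lemma list_cyc:
  assumes "3 \<le> length vs" "length es = length vs" "distinct vs" "set es \<subseteq> E"
    and "\<forall>i<length vs. ends (es ! i) = {vs ! i, vs ! (Suc i mod length vs)}"
  shows "\<exists>n v c. cyc n v c \<and> range c = set es"
proof -
  define n where "n = length vs"
  have n: "3 \<le> n" "0 < n" "length es = n" using assms by (auto simp: n_def)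
  define v where "v i = vs ! (i mod n)" for i
  define c where "c i = es ! (i mod n)" for i
  have lt: "i mod n < n" for i using n(2) by simp
  have "v i \<noteq> v j" if ij: "i < j" "j < i + n" for i j
  proof
    assume "v i = v j"
    then have "i mod n = j mod n"
      using nth_eq_iff_index_eq[OF assms(3)] lt by (simp add: v_def n_def)
    then have "n dvd j - i" using mod_eq_dvd_iff_nat[of i j n] ij by simp
    then show False using ij dvd_imp_le[of n "j - i"] by auto
  qed
  moreover have "ends (c i) = {v i, v (Suc i)}" for i
    using assms(5) lt[of i] by (simp add: c_def v_def n_def mod_Suc_eq)
  moreover have c_set: "c i \<in> set es" for i
    using lt[of i] n(3) by (simp add: c_def)
  ultimately have "cyc n v c"
    unfolding cyc_def using n(1) assms(4) by (auto simp: v_def c_def)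
  moreover have "set es \<subseteq> range c"
  proof
    fix e assume "e \<in> set es"
    then obtain i where "i < n" "e = es ! i" using n(3) by (metis in_set_conv_nth)
    then have "e = c i" by (simp add: c_def)
    then show "e \<in> range c" by simp
  qed
  ultimately show ?thesis using c_set by blast
qed

end

locale cyclic_plane = simple_plane +
  assumes faces_bounded: "\<forall>F\<in>faces V E. bounded_by_simple_cycle V E F"
begin

lemma frontier_cyc:
  assumes "F \<in> faces V E"
  obtains n v c where "cyc n v c" "frontier F = \<Union>(range c)"
proof -
  obtain vs es where "simple_cycle V E vs es" and fr: "frontier F = \<Union>(set es)"
    using faces_bounded assms unfolding bounded_by_simple_cycle_def by blast
  then have "\<exists>n v c. cyc n v c \<and> range c = set es"
    unfolding simple_cycle_def by (intro list_cyc) auto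
  then show ?thesis using fr that by metis
qed

text \<open>The frontier of \<open>F\<close> is a union of edges, and \<open>e\<close> is the only
  edge through \<open>p\<close>.\<close>

lemma frontier_touch:
  assumes "F \<in> faces V E" "e \<in> E" "p \<in> e - V" "p \<in> closure F"
  shows "e \<subseteq> frontier F"
proof -
  from frontier_cyc[OF assms(1)] obtain n v c where c: "cyc n v c" "frontier F = \<Union>(range c)" .
  have "p \<in> skeleton" using assms by (auto simp: skeleton_def)
  then have "p \<notin> F" using face_props(4)[OF assms(1)] by auto
  then have "p \<in> frontier F"
    using assms(4) face_props(1)[OF assms(1)] by (simp add: frontier_def interior_open)
  then have "e \<in> range c" using in_edge_of_cycle[OF c(1) assms(2,3)] c(2) by simp
  then show ?thesis using c(2) by blast
qed

definition edge_set :: "complex set \<Rightarrow> complex set set" where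
  "edge_set F = {e \<in> E. e \<subseteq> frontier F}"

lemma edge_set_cyc:
  assumes "cyc n v c" "frontier F = \<Union>(range c)"
  shows "edge_set F = range c"
proof
  show "edge_set F \<subseteq> range c"
  proof
    fix e assume e: "e \<in> edge_set F"
    then obtain p where p: "p \<in> e - V" using edge_minus_V_nonempty by (auto simp: edge_set_def)
    have "e \<in> E" "p \<in> \<Union>(range c)" using e p assms(2) unfolding edge_set_def by blast+
    then show "e \<in> range c" using in_edge_of_cycle[OF assms(1) _ p] by blast
  qed
  show "range c \<subseteq> edge_set F"
    using cyc_edge(1)[OF assms(1)] assms(2) by (auto simp: edge_set_def)
qed

text \<open>
  Let \<open>F\<close>, \<open>G\<close>, \<open>H\<close> be three faces at \<open>e\<close>. Traverse the frontier cycles of \<open>F\<close> and \<open>G\<close> so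
  that both begin with \<open>e\<close>. The difference of their winding numbers is the winding number of a
  closed path that avoids \<open>e\<close>, so it is the same near \<open>e\<close> in \<open>F\<close> and in \<open>H\<close>. But only
  the winding number of the frontier of \<open>F\<close> differs on these two faces.
\<close>

lemma not_three_faces:
  assumes e: "e \<in> E" and faces: "F \<in> faces V E" "G \<in> faces V E" "H \<in> faces V E"
    and neq: "F \<noteq> G" "F \<noteq> H" "G \<noteq> H"
    and fr: "e \<subseteq> frontier F" "e \<subseteq> frontier G" "e \<subseteq> frontier H"
  shows False
proof -
  obtain g where g: "arc g" "path_image g = e" "ends V e = {pathstart g, pathfinish g}"
    using edge_arc[OF e] .
  obtain p where p: "p \<in> e - V" using edge_minus_V_nonempty[OF e] by blast
  from frontier_cyc[OF faces(1)] obtain n1 v1 c1 where c1: "cyc n1 v1 c1"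
    "frontier F = \<Union>(range c1)" .
  from frontier_cyc[OF faces(2)] obtain n2 v2 c2 where c2: "cyc n2 v2 c2"
    "frontier G = \<Union>(range c2)" .
  have e1: "e \<in> range c1" using in_edge_of_cycle[OF c1(1) e p] p fr(1) c1(2) by blast
  have e2: "e \<in> range c2" using in_edge_of_cycle[OF c2(1) e p] p fr(2) c2(2) by blast
  from cyc_loop[OF c1(1) e1 g] obtain P where P: "arc P" "pathstart P = pathfinish g"
    "pathfinish P = pathstart g" "path_image P = \<Union>(range c1 - {e})" "simple_path (g +++ P)"
    "path_image (g +++ P) = \<Union>(range c1)" .
  from cyc_loop[OF c2(1) e2 g] obtain Q where Q: "arc Q" "pathstart Q = pathfinish g"
    "pathfinish Q = pathstart g" "path_image Q = \<Union>(range c2 - {e})" "simple_path (g +++ Q)"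
    "path_image (g +++ Q) = \<Union>(range c2)" .
  have pathP: "path P" and pathQ: "path Q" and pathg: "path g"
    using P(1) Q(1) g(1) by (auto simp: arc_imp_path)
  have loops: "pathfinish (g +++ P) = pathstart (g +++ P)" "pathfinish (g +++ Q) = pathstart (g +++ Q)"
    using P(3) Q(3) by simp_all
  have "F = inside (path_image (g +++ P)) \<or> F = outside (path_image (g +++ P))"
    using face_side[OF c1(1) faces(1) c1(2)] P(6) by simp
  from winding_number_face[OF P(5) loops(1) this] obtain a1 b1 where ab1: "a1 \<noteq> b1"
    "\<forall>z\<in>F. winding_number (g +++ P) z = a1"
    "\<forall>z. z \<notin> F \<and> z \<notin> path_image (g +++ P) \<longrightarrow> winding_number (g +++ P) z = b1" .
  have "G = inside (path_image (g +++ Q)) \<or> G = outside (path_image (g +++ Q))"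
    using face_side[OF c2(1) faces(2) c2(2)] Q(6) by simp
  from winding_number_face[OF Q(5) loops(2) this] obtain a2 b2 where "a2 \<noteq> b2"
    "\<forall>z\<in>G. winding_number (g +++ Q) z = a2" and
    ab2: "\<forall>z. z \<notin> G \<and> z \<notin> path_image (g +++ Q) \<longrightarrow> winding_number (g +++ Q) z = b2" .
  \<comment> \<open>In the difference of the two traversals the common piece \<open>g\<close>
    cancels, leaving only the complementary arcs.\<close>
  let ?\<delta> = "P +++ reversepath Q"
  have im: "path_image ?\<delta> = \<Union>(range c1 - {e}) \<union> \<Union>(range c2 - {e})"
    using P Q by (simp add: path_image_join)
  have loop: "path ?\<delta>" "pathfinish ?\<delta> = pathstart ?\<delta>"
    using pathP pathQ P Q by (simp_all add: path_join)
  have "p \<notin> path_image ?\<delta>"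
  proof
    assume "p \<in> path_image ?\<delta>"
    then obtain f where f: "f \<in> E" "f \<noteq> e" "p \<in> f"
      unfolding im using cyc_edge(1)[OF c1(1)] cyc_edge(1)[OF c2(1)] by blast
    then show False using edges_meet[OF e f(1)] p by blast
  qed
  moreover have "closed (path_image ?\<delta>)" using loop(1) by (rule closed_path_image)
  ultimately obtain r where r: "r > 0" "ball p r \<inter> path_image ?\<delta> = {}"
    using open_contains_ball[of "- path_image ?\<delta>"]
    by (metis ComplI disjoint_eq_subset_Compl open_Compl)
  have diff: "winding_number (g +++ P) z - winding_number (g +++ Q) z = winding_number ?\<delta> z"
    if z: "z \<in> ball p r" "z \<notin> skeleton" for z
  proof -
    have "path_image g \<subseteq> skeleton" "path_image P \<subseteq> skeleton" "path_image Q \<subseteq> skeleton"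
      using g(2) e P(4) Q(4) cyc_subset_skeleton[OF c1(1)] cyc_subset_skeleton[OF c2(1)]
      by (auto simp: skeleton_def)
    then have z': "z \<notin> path_image g" "z \<notin> path_image P" "z \<notin> path_image Q" using z by auto
    have "winding_number (g +++ P) z = winding_number g z + winding_number P z"
      using pathg pathP z' P(2) by (intro winding_number_join) auto
    moreover have "winding_number (g +++ Q) z = winding_number g z + winding_number Q z"
      using pathg pathQ z' Q(2) by (intro winding_number_join) auto
    moreover have "winding_number ?\<delta> z = winding_number P z + winding_number (reversepath Q) z"
      using pathP pathQ z' P(3) Q(3) by (intro winding_number_join) auto
    moreover have "winding_number (reversepath Q) z = - winding_number Q z"
      using pathQ z' by (intro winding_number_reversepath) auto
    ultimately show ?thesis by simp
  qed
  have const: "winding_number ?\<delta> y = winding_number ?\<delta> z" if "y \<in> ball p r" "z \<in> ball p r" for y z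
    using winding_number_eq[OF loop that connected_ball r(2)] .
  have near: "\<exists>z. z \<in> ball p r \<and> z \<in> K" if "p \<in> frontier K" for K
    using that r(1) unfolding frontier_def by (auto simp: closure_approachable dist_commute)
  obtain y where y: "y \<in> ball p r" "y \<in> F" using near[of F] fr(1) p by blast
  obtain z where z: "z \<in> ball p r" "z \<in> H" using near[of H] fr(3) p by blast
  have ys: "y \<notin> skeleton" and zs: "z \<notin> skeleton"
    using y z face_props(4)[OF faces(1)] face_props(4)[OF faces(3)] by auto
  have out: "y \<notin> G" "z \<notin> F" "z \<notin> G"
    using y z faces_disjoint faces neq by blast+
  have off: "y \<notin> path_image (g +++ P)" "z \<notin> path_image (g +++ P)"
    "y \<notin> path_image (g +++ Q)" "z \<notin> path_image (g +++ Q)"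
    unfolding P(6) Q(6)
    using ys zs cyc_subset_skeleton[OF c1(1)] cyc_subset_skeleton[OF c2(1)] by blast+
  \<comment> \<open>The two sides are the winding number of the difference path at \<open>y\<close>
    in \<open>F\<close> and at \<open>z\<close> in \<open>H\<close>; neither point lies in
    \<open>G\<close>.\<close>
  have "a1 - b2 = b1 - b2"
    using diff[OF y(1) ys] diff[OF z(1) zs] const[OF y(1) z(1)]
      ab1(2) ab1(3) ab2 y(2) out off by simp
  with ab1(1) show False by simp
qed

lemma card_le_2_if_not_three:
  assumes "\<And>a b c. a \<in> S \<Longrightarrow> b \<in> S \<Longrightarrow> c \<in> S \<Longrightarrow> a = b \<or> a = c \<or> b = c"
  shows "finite S \<and> card S \<le> 2"
proof (cases "\<exists>a b. a \<in> S \<and> b \<in> S \<and> a \<noteq> b")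
  case True
  then obtain a b where "a \<in> S" "b \<in> S" "a \<noteq> b" by blast
  then have "S = {a, b}" using assms[of a b] by blast
  then show ?thesis using \<open>a \<noteq> b\<close> by simp
next
  case False
  then have "S = {} \<or> (\<exists>a. S = {a})" by blast
  then show ?thesis by auto
qed

lemma faces_at_edge_le:
  assumes "e \<in> E"
  shows "finite {F \<in> faces V E. e \<subseteq> frontier F} \<and> card {F \<in> faces V E. e \<subseteq> frontier F} \<le> 2"
proof (rule card_le_2_if_not_three)
  fix F G H
  assume "F \<in> {F \<in> faces V E. e \<subseteq> frontier F}" "G \<in> {F \<in> faces V E. e \<subseteq> frontier F}"
    "H \<in> {F \<in> faces V E. e \<subseteq> frontier F}"
  then show "F = G \<or> F = H \<or> G = H" using not_three_faces[OF assms, of F G H] by blast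
qed

text \<open>Every face has an edge on its frontier, and an edge serves at most two faces.\<close>

lemma finite_faces: "finite (faces V E)"
proof -
  have "faces V E \<subseteq> (\<Union>e\<in>E. {F \<in> faces V E. e \<subseteq> frontier F})"
  proof
    fix F assume F: "F \<in> faces V E"
    from frontier_cyc[OF F] obtain n v c where c: "cyc n v c" "frontier F = \<Union>(range c)" .
    then have "c 0 \<in> E" "c 0 \<subseteq> frontier F" using cyc_edge(1)[OF c(1)] by auto
    then show "F \<in> (\<Union>e\<in>E. {F \<in> faces V E. e \<subseteq> frontier F})" using F by blast
  qed
  moreover have "finite (\<Union>e\<in>E. {F \<in> faces V E. e \<subseteq> frontier F})"
    using finite_E faces_at_edge_le by (intro finite_UN_I) auto
  ultimately show ?thesis by (rule finite_subset)
qed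

lemma closure_Union_faces:
  assumes "S \<subseteq> faces V E"
  shows "closure (\<Union>S) = \<Union>(closure ` S)"
  using finite_subset[OF assms finite_faces]
  by (induction S rule: finite_induct) simp_all

text \<open>An inner point of \<open>e\<close> is a limit of points in faces; there are finitely
  many faces, so it is a limit of points of a single one.\<close>

lemma face_at_edge:
  assumes "e \<in> E"
  obtains F where "F \<in> faces V E" "e \<subseteq> frontier F"
proof -
  obtain p where p: "p \<in> e - V" using edge_minus_V_nonempty[OF assms] by blast
  have "p \<in> closure (\<Union>(faces V E))"
    using edge_in_closure_compl[OF assms p] by (simp only: Union_faces)
  then obtain F where "F \<in> faces V E" "p \<in> closure F"
    using closure_Union_faces[OF order_refl] by blast
  then show ?thesis using that frontier_touch[OF _ assms p] by blast
qed

text \<open>Points of \<open>U\<close> close to an inner point of \<open>e\<close> avoid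
  \<open>e\<close>, hence the whole skeleton. So they lie in faces contained in \<open>U\<close>,
  and by finiteness one such face reaches the point.\<close>

lemma face_on_side:
  assumes c: "cyc n v c" and e: "e \<in> range c"
    and U: "U = inside (\<Union>(range c)) \<or> U = outside (\<Union>(range c))"
  obtains F where "F \<in> faces V E" "F \<subseteq> U" "e \<subseteq> frontier F"
proof -
  have eE: "e \<in> E" using e cyc_edge(1)[OF c] by auto
  obtain p where p: "p \<in> e - V" using edge_minus_V_nonempty[OF eE] by blast
  let ?S = "{F \<in> faces V E. F \<subseteq> U}"
  have fr: "frontier U = \<Union>(range c)" using U cyc_jordan(3,6)[OF c refl] by metis
  have disj: "U \<inter> \<Union>(range c) = {}" using U by (metis inside_no_overlap outside_no_overlap)
  have "p \<in> closure U" using p e fr unfolding frontier_def by blast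
  have "p \<in> closure (\<Union>?S)"
    unfolding closure_approachable
  proof (intro allI impI)
    fix r :: real assume "r > 0"
    obtain r' where r': "r' > 0" "ball p r' \<inter> skeleton \<subseteq> e" using near_edge[OF eE p] .
    have "min r r' > 0" using \<open>r > 0\<close> r' by simp
    then obtain z where z: "z \<in> U" "dist z p < min r r'"
      using \<open>p \<in> closure U\<close> unfolding closure_approachable by blast
    then have "z \<in> ball p r'" by (simp add: dist_commute)
    moreover have "z \<notin> e" using z(1) disj e by blast
    ultimately have "z \<in> \<Union>(faces V E)" using r' Union_faces by blast
    then obtain F where F: "F \<in> faces V E" "z \<in> F" by blast
    then have "F \<subseteq> U" using face_subset_side[OF c F(1) U] z by blast
    then show "\<exists>y\<in>\<Union>?S. dist y p < r" using F z(2) by (intro bexI[of _ z]) auto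
  qed
  moreover have "?S \<subseteq> faces V E" by blast
  ultimately obtain F where "F \<in> faces V E" "F \<subseteq> U" "p \<in> closure F"
    using closure_Union_faces[of ?S] by blast
  then show ?thesis using that frontier_touch[OF _ eE p] by blast
qed

lemma sides:
  assumes c: "cyc n v c" and e: "e \<in> range c"
  obtains F G where "F \<noteq> G" "{F \<in> faces V E. e \<subseteq> frontier F} = {F, G}"
    "F \<subseteq> inside (\<Union>(range c))" "G \<subseteq> outside (\<Union>(range c))"
proof -
  have eE: "e \<in> E" using e cyc_edge(1)[OF c] by auto
  from face_on_side[OF c e disjI1[OF refl]] obtain F where F: "F \<in> faces V E"
    "F \<subseteq> inside (\<Union>(range c))" "e \<subseteq> frontier F" .
  from face_on_side[OF c e disjI2[OF refl]] obtain G where G: "G \<in> faces V E"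
    "G \<subseteq> outside (\<Union>(range c))" "e \<subseteq> frontier G" .
  have "F \<noteq> G"
    using F(2) G(2) face_props(3)[OF F(1)] inside_Int_outside[of "\<Union>(range c)"] by blast
  moreover have "{F, G} = {F \<in> faces V E. e \<subseteq> frontier F}"
    using F G faces_at_edge_le[OF eE] \<open>F \<noteq> G\<close> by (intro card_seteq) auto
  ultimately show ?thesis using that[of F G] F G by metis
qed

text \<open>The frontier cycle of one face at \<open>e\<close> passes through \<open>e\<close>, and
  \<open>sides\<close> applies to it.\<close>

lemma two_faces_at_edge:
  assumes "e \<in> E"
  shows "card {F \<in> faces V E. e \<in> edge_set F} = 2"
proof -
  obtain F where F: "F \<in> faces V E" "e \<subseteq> frontier F" using face_at_edge[OF assms] .
  from frontier_cyc[OF F(1)] obtain n v c where c: "cyc n v c" "frontier F = \<Union>(range c)" .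
  have "e \<in> range c" using edge_set_cyc[OF c] F assms by (auto simp: edge_set_def)
  from sides[OF c(1) this] obtain F G where "F \<noteq> G"
    "{F \<in> faces V E. e \<subseteq> frontier F} = {F, G}" .
  moreover have "{F \<in> faces V E. e \<in> edge_set F} = {F \<in> faces V E. e \<subseteq> frontier F}"
    using assms by (auto simp: edge_set_def)
  ultimately show ?thesis by simp
qed

sublocale graph_with_faces V E "ends V" "faces V E" edge_set
proof
  show "finite (faces V E)" by (rule finite_faces)
  show "e \<in> E \<Longrightarrow> card {F \<in> faces V E. e \<in> edge_set F} = 2" for e
    by (rule two_faces_at_edge)
  fix F assume "F \<in> faces V E"
  from frontier_cyc[OF this] obtain n v c where c: "cyc n v c" "frontier F = \<Union>(range c)" .
  then show "\<exists>n v c. cyc n v c \<and> edge_set F = range c" using edge_set_cyc by blast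
qed

text \<open>The faces inside the curve are taken. An edge of the cycle has one face on each side.
  Any other edge has an inner point off the curve, and then both its faces lie on the side of that
  point.\<close>

lemma cyc_is_boundary:
  assumes c: "cyc n v c"
  shows "\<exists>S\<subseteq>faces V E. boundary S = range c"
proof -
  let ?J = "\<Union>(range c)"
  let ?S = "{F \<in> faces V E. F \<subseteq> inside ?J}"
  have "e \<in> boundary ?S \<longleftrightarrow> e \<in> range c" if e: "e \<in> E" for e
  proof -
    have mem: "{F \<in> ?S. e \<in> edge_set F} = {F \<in> faces V E. e \<subseteq> frontier F} \<inter> ?S"
      using e by (auto simp: edge_set_def)
    show ?thesis
    proof
      assume ec: "e \<in> range c"
      from sides[OF c ec] obtain F G where FG: "F \<noteq> G"
        "{F \<in> faces V E. e \<subseteq> frontier F} = {F, G}" "F \<subseteq> inside ?J" "G \<subseteq> outside ?J" .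
      then have FGf: "F \<in> faces V E" "G \<in> faces V E" by auto
      have "\<not> G \<subseteq> inside ?J"
        using FG(4) face_props(3)[OF FGf(2)] inside_Int_outside[of ?J] by blast
      then have "{F \<in> ?S. e \<in> edge_set F} = {F}" unfolding mem FG(2) using FG(3) FGf by auto
      then show "e \<in> boundary ?S" using e by (simp add: boundary_def)
    next
      assume "e \<in> boundary ?S"
      then have one: "card {F \<in> ?S. e \<in> edge_set F} = 1" by (simp add: boundary_def)
      show "e \<in> range c"
      proof (rule ccontr)
        assume ne: "e \<notin> range c"
        obtain p where p: "p \<in> e - V" using edge_minus_V_nonempty[OF e] by blast
        have "p \<notin> ?J" using in_edge_of_cycle[OF c e p] ne by blast
        then have "p \<in> inside ?J \<or> p \<in> outside ?J" using inside_Un_outside[of ?J] by blast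
        then obtain U where U: "U = inside ?J \<or> U = outside ?J" "p \<in> U" by metis
        have "open U" using U(1) cyc_jordan(1,4)[OF c refl] by metis
        have sub: "F \<subseteq> U" if F: "F \<in> faces V E" "e \<subseteq> frontier F" for F
        proof -
          have "p \<in> closure F" using F(2) p by (auto simp: frontier_def)
          then have "F \<inter> U \<noteq> {}" using \<open>open U\<close> U(2) open_Int_closure_eq_empty[of U F] by blast
          then show ?thesis using face_subset_side[OF c F(1) U(1)] by blast
        qed
        show False
          using U(1)
        proof
          assume "U = inside ?J"
          then have "{F \<in> ?S. e \<in> edge_set F} = {F \<in> faces V E. e \<in> edge_set F}"
            using sub unfolding edge_set_def by blast
          then show False using one two_faces_at_edge[OF e] by simp
        next
          assume "U = outside ?J"
          have "F \<notin> ?S" if "e \<in> edge_set F" for F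
          proof
            assume F: "F \<in> ?S"
            then have "F \<subseteq> outside ?J"
              using sub[of F] that \<open>U = outside ?J\<close> by (auto simp: edge_set_def)
            then show False
              using F face_props(3)[of F] inside_Int_outside[of ?J] by blast
          qed
          then have "{F \<in> ?S. e \<in> edge_set F} = {}" by blast
          then show False using one by (simp only: card.empty)
        qed
      qed
    qed
  qed
  moreover have "boundary ?S \<subseteq> E" by (auto simp: boundary_def)
  moreover have "range c \<subseteq> E" using cyc_edge(1)[OF c] by auto
  ultimately have "boundary ?S = range c" by blast
  then show ?thesis by (intro exI[of _ ?S]) auto
qed

text \<open>The plane minus the finite set \<open>V\<close> is connected. With an empty boundary,
  the closures of the union of \<open>S\<close> and of the union of the other faces would split it:
  a common point off \<open>V\<close> lies on an edge whose two faces are one from each set.\<close>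

lemma boundary_neq_empty:
  assumes S: "S \<subseteq> faces V E" "S \<noteq> {}" "S \<noteq> faces V E"
  shows "boundary S \<noteq> {}"
proof
  assume empty: "boundary S = {}"
  let ?T = "faces V E - S"
  have T: "?T \<subseteq> faces V E" by blast
  let ?A = "closure (\<Union>S)" and ?B = "closure (\<Union>?T)"
  have conn: "connected (- V)"
    unfolding Compl_eq_Diff_UNIV
    by (rule connected_open_diff_countable) (use finite_V in \<open>auto simp: countable_finite\<close>)
  have cover: "- V \<subseteq> ?A \<union> ?B"
  proof
    fix p assume p: "p \<in> - V"
    show "p \<in> ?A \<union> ?B"
    proof (cases "p \<in> skeleton")
      case True
      then obtain e where e: "e \<in> E" "p \<in> e - V" using p by (auto simp: skeleton_def)
      obtain F where F: "F \<in> faces V E" "e \<subseteq> frontier F" using face_at_edge[OF e(1)] .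
      then have "p \<in> closure F" using e by (auto simp: frontier_def)
      then have "p \<in> closure (\<Union>S \<union> \<Union>?T)"
        using F(1) closure_mono[of F "\<Union>S \<union> \<Union>?T"] by blast
      then show ?thesis by simp
    next
      case False
      then obtain F where "F \<in> faces V E" "p \<in> F" using Union_faces by blast
      then have "p \<in> \<Union>S \<or> p \<in> \<Union>?T" by blast
      then show ?thesis using closure_subset[of "\<Union>S"] closure_subset[of "\<Union>?T"] by blast
    qed
  qed
  have "?A \<inter> ?B \<inter> - V = {}"
  proof (rule ccontr)
    assume "?A \<inter> ?B \<inter> - V \<noteq> {}"
    then obtain p where p: "p \<in> ?A" "p \<in> ?B" "p \<notin> V" by blast
    obtain F G where F: "F \<in> S" "p \<in> closure F" and G: "G \<in> ?T" "p \<in> closure G"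
      using p closure_Union_faces[OF S(1)] closure_Union_faces[OF T] by blast
    have FG: "F \<in> faces V E" "G \<in> faces V E" "F \<noteq> G" using F(1) G(1) S(1) by auto
    show False
    proof (cases "p \<in> skeleton")
      case True
      then obtain e where e: "e \<in> E" "p \<in> e - V" using p(3) by (auto simp: skeleton_def)
      have "e \<in> edge_set F" "e \<in> edge_set G"
        using frontier_touch[OF FG(1) e F(2)] frontier_touch[OF FG(2) e G(2)] e(1)
        by (auto simp: edge_set_def)
      then have "{F, G} = {F \<in> faces V E. e \<in> edge_set F}"
        using FG two_faces_at_edge[OF e(1)] finite_faces by (intro card_subset_eq) auto
      then have "{H \<in> S. e \<in> edge_set H} = {F}" using F(1) G(1) S(1) by blast
      then have "e \<in> boundary S" using e(1) by (simp add: boundary_def)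
      then show False using empty by simp
    next
      case False
      then obtain H where H: "H \<in> faces V E" "p \<in> H" using Union_faces by blast
      then have "H \<inter> F \<noteq> {}" "H \<inter> G \<noteq> {}"
        using F(2) G(2) face_props(1)[OF H(1)] open_Int_closure_eq_empty by blast+
      then show False using faces_disjoint[OF H(1) FG(1)] faces_disjoint[OF H(1) FG(2)] FG(3) by blast
    qed
  qed
  moreover have "?A \<inter> - V \<noteq> {}" "?B \<inter> - V \<noteq> {}"
  proof -
    obtain F where F: "F \<in> S" using S(2) by blast
    have "F \<subseteq> ?A" "F \<subseteq> - V"
      using F face_props(4)[of F] S(1) closure_subset[of "\<Union>S"] by (auto simp: skeleton_def)
    then show "?A \<inter> - V \<noteq> {}" using face_props(3)[of F] F S(1) by blast
    obtain G where G: "G \<in> ?T" using S by blast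
    have "G \<subseteq> ?B" "G \<subseteq> - V"
      using G face_props(4)[of G] closure_subset[of "\<Union>?T"] by (auto simp: skeleton_def)
    then show "?B \<inter> - V \<noteq> {}" using face_props(3)[of G] G by blast
  qed
  ultimately show False
    using conn cover unfolding connected_closed using closed_closure by blast
qed

sublocale plane_faces V E "ends V" "faces V E" edge_set
  by unfold_locales (use cyc_is_boundary boundary_neq_empty in blast)+

end

section \<open>Application of the critical graph argument to the facial total graph\<close>

section \<open>The facial total graph\<close>

context cyclic_plane
begin

lemma facially_adjacent_iff:
  "e \<in> E \<Longrightarrow> f \<in> E \<Longrightarrow> facially_adjacent V E e f \<longleftrightarrow> fadj e f"
  unfolding facially_adjacent_def fadj_def edge_set_def by blast

lemma total_edges_Inl_Inl:
  "{Inl u, Inl v} \<in> facial_total_edges V E \<longleftrightarrow> u \<in> V \<and> v \<in> V \<and> adjacent V E u v"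
  by (auto simp: facial_total_edges_def doubleton_eq_iff adjacent_def insert_commute)

lemma total_edges_Inr_Inr:
  "{Inr e, Inr f} \<in> facial_total_edges V E \<longleftrightarrow> e \<in> E \<and> f \<in> E \<and> fadj e f"
proof -
  have "{Inr e, Inr f} \<in> facial_total_edges V E \<longleftrightarrow>
      e \<in> E \<and> f \<in> E \<and> (facially_adjacent V E e f \<or> facially_adjacent V E f e)"
    by (auto simp: facial_total_edges_def doubleton_eq_iff)
  then show ?thesis using facially_adjacent_iff fadj_sym by blast
qed

lemma total_edges_Inr_Inl:
  "{Inr e, Inl v} \<in> facial_total_edges V E \<longleftrightarrow> v \<in> V \<and> e \<in> E \<and> v \<in> ends V e"
  by (auto simp: facial_total_edges_def doubleton_eq_iff)

lemma finite_graph_total: "finite_graph (facial_total_edges V E)"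
proof
  fix d assume "d \<in> facial_total_edges V E"
  then consider u v where "d = {Inl u, Inl v}" "u \<noteq> v" | e f where "d = {Inr e, Inr f}" "e \<noteq> f"
    | v e where "d = {Inl v, Inr e}"
    unfolding facial_total_edges_def by (auto simp: adjacent_def facially_adjacent_def)
  then show "\<exists>x y. x \<noteq> y \<and> d = {x, y}"
    by cases (metis sum.inject(1), metis sum.inject(2), metis sum.distinct(1))
qed

interpretation total: finite_graph "facial_total_edges V E"
  by (rule finite_graph_total)

lemma nbs_Inl: "total.nbs (Inl u) \<inter> Inl ` S \<subseteq> Inl ` {v. \<exists>e\<in>E. ends V e = {u, v} \<and> v \<in> S}"
  unfolding total.nbs_def using total_edges_Inl_Inl by (auto simp: adjacent_def)

lemma nbs_Inr: "total.nbs (Inr e) \<subseteq> Inl ` ends V e \<union> Inr ` {f. fadj e f}"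
proof
  fix x assume "x \<in> total.nbs (Inr e)"
  then show "x \<in> Inl ` ends V e \<union> Inr ` {f. fadj e f}"
    by (cases x) (auto simp: total.nbs_def total_edges_Inr_Inl total_edges_Inr_Inr)
qed

lemma good_vertices: "S \<subseteq> V \<Longrightarrow> total.good 5 (Inl ` S)"
proof (induction "card S" arbitrary: S)
  case 0
  then have "S = {}" using finite_V finite_subset by fastforce
  then show ?case by (simp add: total.good_empty)
next
  case (Suc m)
  have fin: "finite S" using Suc.prems finite_V finite_subset by blast
  have "S \<noteq> {}" using Suc.hyps(2) by auto
  then obtain x where x: "x \<in> S" "card {y. \<exists>e\<in>E. ends V e = {x, y} \<and> y \<in> S} \<le> 5"
    using degenerate[OF Suc.prems] by blast
  let ?N = "{y. \<exists>e\<in>E. ends V e = {x, y} \<and> y \<in> S}"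
  have "finite ?N" using fin by (rule rev_finite_subset) auto
  then have "card (total.nbs (Inl x) \<inter> Inl ` S) \<le> card (Inl ` ?N :: (complex + complex set) set)"
    by (intro card_mono nbs_Inl) auto
  also have "\<dots> \<le> 5" using x(2) by (simp add: card_image)
  finally have deg: "card (total.nbs (Inl x) \<inter> Inl ` S) \<le> 5" .
  have "card (S - {x}) = m" using Suc.hyps(2) x(1) fin by simp
  then have "total.good 5 (Inl ` (S - {x}))" using Suc.hyps(1)[of "S - {x}"] Suc.prems by blast
  moreover have "Inl ` S - {Inl x} = (Inl ` (S - {x}) :: (complex + complex set) set)" by auto
  ultimately have "total.good 5 (Inl ` S - {Inl x})" by (simp only:)
  then show ?case
    using total.good_remove[of "Inl ` S" "Inl x" 5] fin x(1) deg by simp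
qed

lemma finite_fadj: "finite {f. fadj e f}"
proof (rule finite_subset)
  show "{f. fadj e f} \<subseteq> E" by (auto simp: fadj_def edge_set_def)
qed (rule finite_E)

lemma card_nbs_Inr_le:
  assumes "e \<in> E"
  shows "card (total.nbs (Inr e) \<inter> T) \<le> 2 + card {f. fadj e f}"
proof -
  have fin: "finite (ends V e)" using finite_subset[OF ends_subset[OF assms] finite_V] .
  have "card (total.nbs (Inr e) \<inter> T) \<le> card (Inl ` ends V e \<union> Inr ` {f. fadj e f})"
    using nbs_Inr[of e] fin finite_fadj by (intro card_mono) auto
  also have "\<dots> \<le> card (Inl ` ends V e :: (complex + complex set) set) +
      card (Inr ` {f. fadj e f} :: (complex + complex set) set)" by (rule card_Un_le)
  also have "\<dots> = 2 + card {f. fadj e f}" using card_ends[OF assms] by (simp add: card_image)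
  finally show ?thesis .
qed

text \<open>Two ends that meet all three sides of a triangle are two of its vertices, so
  \<open>g\<close> would be parallel to a side.\<close>

lemma not_adjacent_to_triangle:
  assumes c: "cyc n v c" "n = 3" and g: "g \<in> E" "g \<notin> range c"
    and adj: "\<And>i. ends V g \<inter> ends V (c i) \<noteq> {}"
  shows False
proof -
  obtain x y where xy: "x \<noteq> y" "ends V g = {x, y}" using ends[OF g(1)] by blast
  have v3: "v 3 = v 0" using cyc_period(1)[OF c(1), of 0] c(2) by simp
  have c012: "ends V (c 0) = {v 0, v 1}" "ends V (c 1) = {v 1, v 2}" "ends V (c 2) = {v 2, v 0}"
    using cyc_edge(2)[OF c(1), of 0] cyc_edge(2)[OF c(1), of 1] cyc_edge(2)[OF c(1), of 2] v3
    by (simp_all add: numeral_2_eq_2 numeral_3_eq_3)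
  have "{x, y} \<inter> {v 0, v 1} \<noteq> {}" "{x, y} \<inter> {v 1, v 2} \<noteq> {}" "{x, y} \<inter> {v 2, v 0} \<noteq> {}"
    using adj[of 0] adj[of 1] adj[of 2] c012 xy by auto
  moreover have "v 0 \<noteq> v 1" "v 1 \<noteq> v 2" "v 0 \<noteq> v 2"
    using cyc_v_neq[OF c(1)] c(2) by simp_all
  ultimately have "{x, y} = {v 0, v 1} \<or> {x, y} = {v 1, v 2} \<or> {x, y} = {v 2, v 0}"
    unfolding Int_insert_left insert_iff empty_iff doubleton_eq_iff by (auto split: if_splits)
  then have "ends V g = ends V (c 0) \<or> ends V g = ends V (c 1) \<or> ends V g = ends V (c 2)"
    using c012 xy(2) by simp
  then show False using ends_eqD[OF g(1) cyc_edge(1)[OF c(1)]] g(2) by blast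
qed

text \<open>A failure makes \<open>E\<close> critical over \<open>V\<close>. For a face cycle,
  \<open>separated_by_cycle_vertex\<close> then yields a set attached at a single edge of the face,
  which \<open>no_cut_edge\<close> excludes.\<close>

lemma good_total: "total.good 5 (Inl ` V \<union> Inr ` E)"
proof (rule ccontr)
  assume bad: "\<not> total.good 5 (Inl ` V \<union> Inr ` E)"
  have "E \<noteq> {}" using bad good_vertices[of V] by auto
  interpret critical_graph "facial_total_edges V E" "Inl ` V" "Inr ` E" 5
  proof
    show "card (total.nbs x \<inter> (Inl ` V \<union> Inr ` E)) \<le> Suc 5" if x: "x \<in> Inr ` E" for x
    proof -
      obtain e where e: "x = Inr e" "e \<in> E" using x by blast
      then show ?thesis
        using card_nbs_Inr_le[OF e(2), of "Inl ` V \<union> Inr ` E"] card_fadj_le[OF e(2)] by simp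
    qed
    show "\<exists>x\<in>T. \<exists>y\<in>Inr ` E - T. y \<in> total.nbs x"
      if T: "T \<subseteq> Inr ` E" "T \<noteq> {}" "T \<noteq> Inr ` E" for T
    proof -
      obtain T' where T': "T' \<subseteq> E" "T = Inr ` T'" using T(1) by (meson subset_imageE)
      then have "T' \<noteq> {}" "T' \<noteq> E" using T by auto
      from fadj_connected[OF T'(1) this]
      obtain e f where ef: "e \<in> T'" "f \<in> E - T'" "fadj e f" by blast
      then have "Inr f \<in> total.nbs (Inr e)"
        using T'(1) by (auto simp: total.nbs_def total_edges_Inr_Inr)
      then show ?thesis using ef T'(2) by (intro bexI[of _ "Inr e"] bexI[of _ "Inr f"]) auto
    qed
  qed (use finite_V finite_E good_vertices[of V] bad in auto)
  \<comment> \<open>Criticality forces degree 6, and the ends of the edge account for only two of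
    the neighbours.\<close>
  have four: "4 \<le> card {f. fadj e f}" if "e \<in> E" for e
    using degree_eq[of "Inr e"] card_nbs_Inr_le[OF that, of "Inl ` V \<union> Inr ` E"] that by simp
  obtain e where e: "e \<in> E" using \<open>E \<noteq> {}\<close> by blast
  obtain F where F: "F \<in> faces V E" "e \<subseteq> frontier F" using face_at_edge[OF e] .
  from frontier_cyc[OF F(1)] obtain n v c where c: "cyc n v c" "frontier F = \<Union>(range c)" .
  have bd: "edge_set F = range c" by (rule edge_set_cyc[OF c])
  have n: "3 \<le> n" by (rule cyc_ge_3[OF c(1)])
  define c' :: "nat \<Rightarrow> complex + complex set" where "c' i = Inr (c i)" for i
  have adj': "c' j \<in> total.nbs (c' i) \<longleftrightarrow> fadj (c i) (c j)" for i j
    using cyc_edge(1)[OF c(1)] by (simp add: c'_def total.nbs_def total_edges_Inr_Inr)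
  have cycle: "induced_cycle n c'"
    unfolding induced_cycle_def adj'
    using n cyc_period(2)[OF c(1)] cyc_edge(1)[OF c(1)] cyc_c_neq[OF c(1)]
      fadj_cyc[OF c(1) F(1) bd] by (auto simp: c'_def)
  have nall: "\<not> range c' \<subseteq> total.nbs z" if z: "z \<in> Inr ` E - range c'" for z
  proof
    assume sub: "range c' \<subseteq> total.nbs z"
    obtain g where g: "g \<in> E" "z = Inr g" using z by auto
    have g': "g \<notin> range c"
    proof
      assume "g \<in> range c"
      then obtain i where "z = c' i" using g(2) by (auto simp: c'_def)
      then show False using z by simp
    qed
    have adj: "fadj g (c i)" for i
    proof -
      have "Inr (c i) \<in> total.nbs (Inr g)" using sub g(2) by (auto simp: c'_def)
      then show ?thesis by (simp add: total.nbs_def total_edges_Inr_Inr)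
    qed
    \<comment> \<open>An edge has at most four facial neighbours, so a cycle of common neighbours
      has length at most 4. As its length is odd it is a triangle.\<close>
    have "card (c ` {..<n}) \<le> card {f. fadj g f}"
      using adj finite_fadj by (intro card_mono) auto
    moreover have "inj_on c {..<n}"
      by (rule linorder_inj_onI') (use cyc_c_neq[OF c(1)] in auto)
    ultimately have "n \<le> 4" using card_fadj_le[OF g(1)] by (simp add: card_image)
    moreover have "odd n" using induced_cycle_reach[OF cycle] by blast
    ultimately have "n = 3" using n by (cases "n = 4") auto
    then show False
      using not_adjacent_to_triangle[OF c(1) _ g(1) g'] adj by (auto simp: fadj_def)
  qed
  obtain K where K: "K \<subseteq> Inr ` E - range c'"
    "\<And>x. x \<in> K \<Longrightarrow> total.nbs x \<inter> Inr ` E \<subseteq> insert (c' 0) K"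
    "total.nbs (c' 0) \<inter> Inr ` E \<subseteq> K \<union> range c'"
    using separated_by_cycle_vertex[OF cycle nall] by blast
  define L where "L = {g. Inr g \<in> K}"
  have fE: "f \<in> E" "g \<in> E" if "fadj f g" for f g using that by (auto simp: fadj_def edge_set_def)
  have mem: "Inr g \<in> total.nbs (Inr f) \<inter> Inr ` E" if "fadj f g" for f g
    using that fE[OF that] by (auto simp: total.nbs_def total_edges_Inr_Inr)
  show False
  proof (rule no_cut_edge)
    show "c 0 \<in> E" "c 0 \<in> edge_set F" using cyc_edge(1)[OF c(1)] bd by auto
    then show "4 \<le> card {f. fadj (c 0) f}" using four by blast
    show "L \<subseteq> E - edge_set F"
    proof
      fix g assume "g \<in> L"
      then have "Inr g \<in> Inr ` E" "Inr g \<notin> range c'" using K(1) by (auto simp: L_def)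
      then show "g \<in> E - edge_set F" unfolding bd by (auto simp: c'_def)
    qed
    show "g \<in> L \<or> g = c 0" if "f \<in> L" "fadj f g" for f g
      using K(2)[of "Inr f"] mem[OF that(2)] that(1) by (auto simp: L_def c'_def)
    show "g \<in> L \<union> edge_set F" if "fadj (c 0) g" for g
      using K(3) mem[OF that] unfolding bd by (auto simp: L_def c'_def)
  qed (rule F(1))
qed

lemma Alon_Tarsi_number_total:
  "Alon_Tarsi_number (facial_total_vertices V E) (facial_total_edges V E) \<le> 6"
proof -
  have W: "facial_total_vertices V E = Inl ` V \<union> Inr ` E"
    by (auto simp: facial_total_vertices_def)
  have "Alon_Tarsi_number (facial_total_vertices V E) (facial_total_edges V E) \<le> Suc 5"
  proof (rule total.Alon_Tarsi_number_le)
    show "finite (facial_total_vertices V E)" using finite_V finite_E by (simp add: W)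
    show "\<Union>(facial_total_edges V E) \<subseteq> facial_total_vertices V E"
      by (auto simp: facial_total_edges_def W)
    show "total.good 5 (facial_total_vertices V E)" using good_total by (simp add: W)
  qed
  then show ?thesis by simp
qed

end

theorem theorem3p5:
  fixes V :: "complex set" and E :: "complex set set"
  assumes "simple_plane_graph V E"
    and "graph_connected V E"
    and "\<forall>F\<in>faces V E. bounded_by_simple_cycle V E F"
  shows "Alon_Tarsi_number (facial_total_vertices V E) (facial_total_edges V E) \<le> 6"
proof -
  interpret cyclic_plane V E by unfold_locales (fact assms)+
  show ?thesis by (rule Alon_Tarsi_number_total)
qed

end
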